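(* Let $\mu$ be a probability measure on $\Sigma\subset B_3/Z$ such that $\bigcup_n\mathrm{supp}(\mu^{*n})=B_3/Z$. Let $r\in\{x\in(\mathbb{R}_+^* )^{\Sigma}\mid\sum_{u\in\Sigma}x(u)=1\}$ be the unique solution in this set to the Traffic Equations of $(B_3/Z,\mu)$ (see context). For $u\in\Sigma$ set $q(u)=r(u)/r(\mathrm{Next}(u))$. With $\widehat q$, $Q$, $\Gamma$ as defined in the context, the following hold. (1) For all $u\in\Sigma$, $\ \widehat q(u)=\dfrac{r(u)}{r(\mathrm{Next}(u))}=q(u)$. (2) $\ \widehat q(1)=\sum_{u\in\Sigma}\mu(u)\,q(u^{-1})$ and $\ \widehat q(\Delta)=\sum_{u\in\Sigma}\mu(u)\,q(u^{-1}\Delta)$. (3) The probabilities of ever reaching an element are given by $Q(\Delta)=\widehat q(\Delta)/(1-\widehat q(1))$ and, for every $v\in (B_3/Z)\setminus\{1,\Delta\}$, with $k=|v|_T$, $$Q(v)=\sum_{u_1\cdots u_k\in\psi^{-1}(v)}q(u_1)\cdots q(u_{k-1})\bigl[q(u_k)+q(u_k\Delta)\,Q(\Delta)\bigr].$$ (4) The Green function is determined by $\Gamma(\cdot)=\Gamma(1)Q(\cdot)$ and $$\Gamma(1)=\frac{1-\widehat q(1)}{(1-\widehat q(1))^2-\widehat q(\Delta)^2}.$$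
   Context: $B_3=\langle a,b\mid aba=bab\rangle$ is the braid group on three strands, $\Delta=aba=bab$, and $Z=\langle\Delta^2\rangle$ is the center of $B_3$. Elements of $B_3$ and their images in $B_3/Z$ are denoted by the same symbols; in $B_3/Z$ one has $\Delta^2=1$. Let $T=\{a,b,ab,ba\}$ and $\Sigma=\{a,b,ab,ba,a\Delta,b\Delta,ab\Delta,ba\Delta\}\subset B_3/Z$. The set $\Sigma$ is stable under inversion and under $u\mapsto u\Delta$. Let $\iota$ be conjugation by $\Delta$, i.e. $\iota(u)=\Delta u\Delta^{-1}$, which exchanges $a$ and $b$ and fixes $\Delta$. Define $\mathrm{First},\mathrm{Last}:\Sigma\to\{a,b\}$ as follows: for $t\in T$, $\mathrm{First}(t)$ and $\mathrm{Last}(t)$ are the first and last letter of $t$ (e.g. $\mathrm{First}(ab)=a$, $\mathrm{Last}(ab)=b$), and $\mathrm{First}(t\Delta)=\mathrm{First}(t)$, $\mathrm{Last}(t\Delta)=\iota(\mathrm{Last}(t))$. For $u\in\Sigma$ put $\mathrm{Next}(u)=\{v\in\Sigma\mid\mathrm{First}(v)=\mathrm{Last}(u)\}$, $F_u=\{v\in\Sigma\mid\mathrm{First}(v)=\mathrm{First}(u)\}$, and for $x\in\mathbb{R}^{\Sigma}$ put $x(\mathrm{Next}(u))=\sum_{v\in\mathrm{Next}(u)}x(v)$. Every $g\in B_3/Z$ is written uniquely as $g=t_1\cdots t_k\Delta^{\varepsilon}$ with $k\ge0$, $t_i\in T$, $\mathrm{Last}(t_i)=\mathrm{First}(t_{i+1})$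 for $1\le i<k$, $\varepsilon\in\{0,1\}$ (Garside normal form); put $|g|_T=k$. For $v\in B_3/Z$ with $|v|_T=k\ge1$, $\psi^{-1}(v)$ denotes the set of words $u_1\cdots u_k\in\Sigma^k$ such that $u_{i+1}\in\mathrm{Next}(u_i)$ for $1\le i<k$ and whose product $u_1u_2\cdots u_k$ in $B_3/Z$ equals $v$. The Traffic Equations of $(B_3/Z,\mu)$ are the following equations in $x\in(\mathbb{R}_+^* )^{\Sigma}$: for all $u\in\Sigma$, $$x(u)=\mu(u)\,x(\mathrm{Next}(u))+\sum_{v\in F_u\setminus\{u,u\Delta\}}\mu(v)\,x(v^{-1}u)+\sum_{v\in\Sigma\setminus F_u}\mu(v)\left[\frac{x(v^{-1})}{x(\mathrm{Next}(v^{-1}))}\,x(u)+\frac{x(v^{-1}\Delta)}{x(\mathrm{Next}(v^{-1}\Delta))}\,x(\iota(u)\Delta)\right].$$ They have a unique solution $r$ in $\{x\in(\mathbb{R}_+^* )^{\Sigma}\mid\sum_{u\in\Sigma}x(u)=1\}$ (known). Let $(Y_n)_{n\ge1}$ be a realization of the (transient) random walk $(B_3/Z,\mu)$, indexed so that it starts at time $1$: $Y_1=1$ and $Y_{n+1}=Y_n y_n$ with $(y_n)_{n\ge 1}$ i.i.d. of law $\mu$. For $u\in B_3/Z$ define $$Q(u)=P\{\exists n\ge1\mid Y_n=u\},\qquad \Gamma(u)=\sum_{i=0}^{\infty}\mu^{*i}(u),$$ $$\widehat q(u)=P\{\exists n>1\mid Y_n=u\ \text{and}\ \forall\,1<m<n,\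 Y_m\ne u\Delta\}.$$ *)

theory Defs
  imports
    "HOL-Probability.Probability"
    "HOL-Algebra.Coset"
    "HOL-Algebra.Generated_Groups"
begin

section \<open>The braid group on three strands\<close>

text \<open>\<open>B3\<close> is the group presented by \<open>a, b\<close> with the single relation \<open>aba = bab\<close>:
  words in the letters \<open>(x, True)\<close> (the generator \<open>x\<close>) and \<open>(x, False)\<close> (its inverse),
  modulo the smallest congruence generated by free cancellation and the braid relation.\<close>

datatype gen = GA | GB

type_synonym word = "(gen \<times> bool) list"

inductive braid_eq :: "word \<Rightarrow> word \<Rightarrow> bool" where
  refl: "braid_eq w w"
| sym: "braid_eq v w \<Longrightarrow> braid_eq w v"
| trans: "braid_eq u v \<Longrightarrow> braid_eq v w \<Longrightarrow> braid_eq u w"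
| cancel: "braid_eq (u @ [(x, e), (x, \<not> e)] @ w) (u @ w)"
| braid: "braid_eq (u @ [(GA, True), (GB, True), (GA, True)] @ w)
                   (u @ [(GB, True), (GA, True), (GB, True)] @ w)"

definition braid_rel :: "(word \<times> word) set" where
  "braid_rel = {(v, w). braid_eq v w}"

definition braid_class :: "word \<Rightarrow> word set" where
  "braid_class w = braid_rel `` {w}"

definition B3 :: "word set monoid" where
  "B3 = \<lparr>carrier = UNIV // braid_rel,
         mult = (\<lambda>X Y. \<Union>u\<in>X. \<Union>v\<in>Y. braid_class (u @ v)),
         one = braid_class []\<rparr>"

definition a0 :: "word set" where "a0 = braid_class [(GA, True)]"
definition b0 :: "word set" where "b0 = braid_class [(GB, True)]"
definition \<Delta>0 :: "word set" where "\<Delta>0 = a0 \<otimes>\<^bsub>B3\<^esub> b0 \<otimes>\<^bsub>B3\<^esub> a0"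

definition ZB :: "word set set" where
  "ZB = generate B3 {\<Delta>0 \<otimes>\<^bsub>B3\<^esub> \<Delta>0}"

lemma equiv_braid_rel: "equiv UNIV braid_rel"
proof (rule equivI)
  show "refl braid_rel" by (simp add: refl_on_def braid_rel_def braid_eq.refl)
  show "sym braid_rel" using braid_eq.sym by (simp add: sym_def braid_rel_def)
  show "trans braid_rel"
    unfolding trans_def braid_rel_def using braid_eq.trans by blast
qed simp

lemma braid_class_eq_iff: "braid_class v = braid_class w \<longleftrightarrow> braid_eq v w"
  using eq_equiv_class_iff[OF equiv_braid_rel UNIV_I UNIV_I, of v w]
  by (simp add: braid_class_def braid_rel_def)

lemma braid_eq_ctxt: "braid_eq v w \<Longrightarrow> braid_eq (p @ v @ s) (p @ w @ s)"
proof (induction rule: braid_eq.induct)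
  case (cancel u x e w)
  then show ?case using braid_eq.cancel[of "p @ u" x e "w @ s"] by simp
next
  case (braid u w)
  then show ?case using braid_eq.braid[of "p @ u" "w @ s"] by simp
next
  case (trans u v w)
  show ?case by (rule braid_eq.trans[OF trans.IH])
qed (simp_all add: braid_eq.refl braid_eq.sym)

lemma braid_eq_append: "braid_eq v v' \<Longrightarrow> braid_eq w w' \<Longrightarrow> braid_eq (v @ w) (v' @ w')"
  using braid_eq.trans[of "v @ w" "v' @ w" "v' @ w'"]
    braid_eq_ctxt[of v v' "[]" w] braid_eq_ctxt[of w w' v' "[]"]
  by simp

lemma carrier_B3: "carrier B3 = range braid_class"
  by (auto simp: B3_def braid_class_def quotient_def)

lemma one_B3: "\<one>\<^bsub>B3\<^esub> = braid_class []"
  by (simp add: B3_def)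

lemma mult_B3: "braid_class v \<otimes>\<^bsub>B3\<^esub> braid_class w = braid_class (v @ w)"
proof -
  have eq: "braid_class (v' @ w') = braid_class (v @ w)"
    if "v' \<in> braid_class v" "w' \<in> braid_class w" for v' w'
    using that unfolding braid_class_eq_iff
    by (simp add: braid_class_def braid_rel_def braid_eq.sym braid_eq_append)
  have "v \<in> braid_class v" "w \<in> braid_class w"
    by (simp_all add: braid_class_def braid_rel_def braid_eq.refl)
  then have "(\<Union>v'\<in>braid_class v. \<Union>w'\<in>braid_class w. braid_class (v' @ w')) = braid_class (v @ w)"
    using eq by blast
  then show ?thesis by (simp add: B3_def)
qed

lemma braid_eq_inverse: "\<exists>v. braid_eq (v @ w) []"
proof (induction w)
  case Nil
  then show ?case by (intro exI[of _ "[]"]) (simp add: braid_eq.refl)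
next
  case (Cons l w)
  then obtain v where v: "braid_eq (v @ w) []" by blast
  obtain x e where l: "l = (x, e)" by force
  have "braid_eq (v @ [(x, \<not> e), (x, \<not> \<not> e)] @ w) (v @ w)"
    by (rule braid_eq.cancel)
  then have "braid_eq ((v @ [(x, \<not> e)]) @ l # w) []"
    using braid_eq.trans[OF _ v] by (simp add: l)
  then show ?case by blast
qed

lemma group_B3: "group B3"
proof (rule groupI)
  fix X assume "X \<in> carrier B3"
  then obtain w where w: "X = braid_class w" by (auto simp: carrier_B3)
  obtain v where "braid_eq (v @ w) []" using braid_eq_inverse by blast
  then show "\<exists>Y\<in>carrier B3. Y \<otimes>\<^bsub>B3\<^esub> X = \<one>\<^bsub>B3\<^esub>"
    by (intro bexI[of _ "braid_class v"])
       (auto simp: w mult_B3 one_B3 braid_class_eq_iff carrier_B3)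
qed (auto simp: carrier_B3 mult_B3 one_B3)

lemma braid_eq_central:
  fixes w :: word
  defines "d \<equiv> [(GA, True), (GB, True), (GA, True)]"
  shows "braid_eq (d @ d @ w) (w @ d @ d)"
proof -
  define d' where "d' = [(GB, True), (GA, True), (GB, True)]"
  define fl where "fl = (\<lambda>x. case x of GA \<Rightarrow> GB | GB \<Rightarrow> GA)"
  have dd: "braid_eq d d'"
    using braid_eq.braid[of "[]" "[]"] by (simp add: d_def d'_def)
  have pos: "braid_eq (d @ [(x, True)]) ([(fl x, True)] @ d)" for x
  proof (cases x)
    case GA
    have "braid_eq (d @ [(GA, True)]) (d' @ [(GA, True)])"
      by (rule braid_eq_append[OF dd braid_eq.refl])
    also have "d' @ [(GA, True)] = [(GB, True)] @ d" by (simp add: d_def d'_def)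
    finally show ?thesis by (simp add: GA fl_def)
  next
    case GB
    have "d @ [(GB, True)] = [(GA, True)] @ d'" by (simp add: d_def d'_def)
    moreover have "braid_eq ([(GA, True)] @ d') ([(GA, True)] @ d)"
      by (rule braid_eq_append[OF braid_eq.refl braid_eq.sym[OF dd]])
    ultimately show ?thesis by (simp add: GB fl_def)
  qed
  have letter: "braid_eq (d @ [(x, e)]) ([(fl x, e)] @ d)" for x e
  proof (cases e)
    case True
    then show ?thesis using pos by simp
  next
    case False
    have "braid_eq (d @ [(x, False)]) ([(fl x, False), (fl x, True)] @ d @ [(x, False)])"
      using braid_eq.cancel[of "[]" "fl x" False "d @ [(x, False)]"]
      by (simp add: braid_eq.sym)
    moreover have "braid_eq ([(fl x, False)] @ ([(fl x, True)] @ d) @ [(x, False)])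
        ([(fl x, False)] @ (d @ [(x, True)]) @ [(x, False)])"
      by (intro braid_eq_ctxt braid_eq.sym[OF pos])
    moreover have "braid_eq (([(fl x, False)] @ d) @ [(x, True), (x, \<not> True)] @ [])
        (([(fl x, False)] @ d) @ [])"
      by (rule braid_eq.cancel)
    ultimately show ?thesis 
      using False braid_eq.trans[of "d @ [(x, False)]" "[(fl x, False), (fl x, True)] @ d @ [(x, False)]"]
        braid_eq.trans[of "[(fl x, False), (fl x, True)] @ d @ [(x, False)]"
          "[(fl x, False)] @ d @ [(x, True), (x, False)]"]
      by simp
  qed
  have fl2: "fl (fl x) = x" for x by (cases x) (auto simp: fl_def)
  have letter2: "braid_eq (d @ d @ [l]) ([l] @ d @ d)" for l
  proof -
    obtain x e where l: "l = (x, e)" by force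
    have "braid_eq (d @ (d @ [(x, e)]) @ []) (d @ ([(fl x, e)] @ d) @ [])"
      by (intro braid_eq_ctxt letter)
    moreover have "braid_eq ([] @ (d @ [(fl x, e)]) @ d) ([] @ ([(fl (fl x), e)] @ d) @ d)"
      by (intro braid_eq_ctxt letter)
    ultimately show ?thesis 
      using braid_eq.trans[of "d @ d @ [l]" "d @ [(fl x, e)] @ d" "[l] @ d @ d"]
      by (simp add: l fl2)
  qed
  show ?thesis
  proof (induction w)
    case Nil
    then show ?case by (simp add: braid_eq.refl)
  next
    case (Cons l w)
    have "braid_eq ([] @ (d @ d @ [l]) @ w) ([] @ ([l] @ d @ d) @ w)"
      by (intro braid_eq_ctxt letter2)
    moreover have "braid_eq ([l] @ (d @ d @ w) @ []) ([l] @ (w @ d @ d) @ [])"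
      by (intro braid_eq_ctxt Cons)
    ultimately show ?case
      using braid_eq.trans[of "d @ d @ l # w" "l # d @ d @ w" "l # w @ d @ d"] by simp
  qed
qed

lemma \<Delta>0_eq: "\<Delta>0 = braid_class [(GA, True), (GB, True), (GA, True)]"
  by (simp add: \<Delta>0_def a0_def b0_def mult_B3)

lemma normal_Z: "ZB \<lhd> B3"
proof -
  interpret group B3 by (rule group_B3)
  have D: "\<Delta>0 \<in> carrier B3" by (simp add: \<Delta>0_eq carrier_B3)
  have central: "X \<otimes>\<^bsub>B3\<^esub> (\<Delta>0 \<otimes>\<^bsub>B3\<^esub> \<Delta>0) = (\<Delta>0 \<otimes>\<^bsub>B3\<^esub> \<Delta>0) \<otimes>\<^bsub>B3\<^esub> X"
    if X: "X \<in> carrier B3" for X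
  proof -
    obtain w where w: "X = braid_class w" using X by (auto simp: carrier_B3)
    show ?thesis
      using braid_eq.sym[OF braid_eq_central[of w]]
      by (simp add: w \<Delta>0_eq mult_B3 braid_class_eq_iff)
  qed
  show ?thesis
    unfolding ZB_def
  proof (rule normal_generateI)
    show "{\<Delta>0 \<otimes>\<^bsub>B3\<^esub> \<Delta>0} \<subseteq> carrier B3" using D by simp
  next
    fix h g assume h: "h \<in> {\<Delta>0 \<otimes>\<^bsub>B3\<^esub> \<Delta>0}" and g: "g \<in> carrier B3"
    then have "g \<otimes>\<^bsub>B3\<^esub> h \<otimes>\<^bsub>B3\<^esub> inv\<^bsub>B3\<^esub> g = h \<otimes>\<^bsub>B3\<^esub> g \<otimes>\<^bsub>B3\<^esub> inv\<^bsub>B3\<^esub> g"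
      using central by simp
    also have "\<dots> = h" using h g D by (simp add: m_assoc)
    finally show "g \<otimes>\<^bsub>B3\<^esub> h \<otimes>\<^bsub>B3\<^esub> inv\<^bsub>B3\<^esub> g \<in> {\<Delta>0 \<otimes>\<^bsub>B3\<^esub> \<Delta>0}" using h by simp
  qed
qed

section \<open>The quotient by the center\<close>

type_synonym b3z = "word set set"

definition B3Z :: "b3z monoid" where
  "B3Z = B3 Mod ZB"

lemma group_B3Z: "group B3Z"
  unfolding B3Z_def by (rule normal.factorgroup_is_group[OF normal_Z])

definition aZ :: b3z where "aZ = ZB #>\<^bsub>B3\<^esub> a0"
definition bZ :: b3z where "bZ = ZB #>\<^bsub>B3\<^esub> b0"
definition \<Delta> :: b3z where "\<Delta> = ZB #>\<^bsub>B3\<^esub> \<Delta>0"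

definition iota :: "b3z \<Rightarrow> b3z" where
  "iota u = \<Delta> \<otimes>\<^bsub>B3Z\<^esub> u \<otimes>\<^bsub>B3Z\<^esub> inv\<^bsub>B3Z\<^esub> \<Delta>"

definition Tset :: "b3z set" where
  "Tset = {aZ, bZ, aZ \<otimes>\<^bsub>B3Z\<^esub> bZ, bZ \<otimes>\<^bsub>B3Z\<^esub> aZ}"

definition Sig :: "b3z set" where
  "Sig = Tset \<union> (\<lambda>t. t \<otimes>\<^bsub>B3Z\<^esub> \<Delta>) ` Tset"

definition FirstT :: "b3z \<Rightarrow> b3z" where
  "FirstT t = (if t \<in> {aZ, aZ \<otimes>\<^bsub>B3Z\<^esub> bZ} then aZ else bZ)"

definition LastT :: "b3z \<Rightarrow> b3z" where
  "LastT t = (if t \<in> {aZ, bZ \<otimes>\<^bsub>B3Z\<^esub> aZ} then aZ else bZ)"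

text \<open>For \<open>u = t\<Delta>\<close> with \<open>t \<in> Tset\<close>, the element \<open>t\<close> is recovered as \<open>u\<Delta>\<close>, because
  \<open>\<Delta>\<^sup>2 = 1\<close> in the quotient. The values outside \<open>Sig\<close> are irrelevant.\<close>

definition First :: "b3z \<Rightarrow> b3z" where
  "First u = (if u \<in> Tset then FirstT u else FirstT (u \<otimes>\<^bsub>B3Z\<^esub> \<Delta>))"

definition Last :: "b3z \<Rightarrow> b3z" where
  "Last u = (if u \<in> Tset then LastT u else iota (LastT (u \<otimes>\<^bsub>B3Z\<^esub> \<Delta>)))"

definition Next :: "b3z \<Rightarrow> b3z set" where
  "Next u = {v \<in> Sig. First v = Last u}"

definition Fset :: "b3z \<Rightarrow> b3z set" where
  "Fset u = {v \<in> Sig. First v = First u}"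

definition gprod :: "b3z list \<Rightarrow> b3z" where
  "gprod us = foldr (\<otimes>\<^bsub>B3Z\<^esub>) us \<one>\<^bsub>B3Z\<^esub>"

definition garside_nf :: "b3z \<Rightarrow> b3z list \<Rightarrow> nat \<Rightarrow> bool" where
  "garside_nf g ts \<epsilon> \<longleftrightarrow>
     set ts \<subseteq> Tset \<and>
     (\<forall>i. Suc i < length ts \<longrightarrow> Last (ts ! i) = First (ts ! Suc i)) \<and>
     \<epsilon> \<in> {0, 1} \<and>
     g = gprod ts \<otimes>\<^bsub>B3Z\<^esub> \<Delta> [^]\<^bsub>B3Z\<^esub> \<epsilon>"

definition lenT :: "b3z \<Rightarrow> nat" where
  "lenT g = (THE k. \<exists>ts \<epsilon>. garside_nf g ts \<epsilon> \<and> length ts = k)"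

definition psi_inv :: "b3z \<Rightarrow> b3z list set" where
  "psi_inv v = {us. length us = lenT v \<and> set us \<subseteq> Sig \<and>
     (\<forall>i. Suc i < length us \<longrightarrow> us ! Suc i \<in> Next (us ! i)) \<and>
     gprod us = v}"

section \<open>Traffic Equations\<close>

definition traffic_equations :: "b3z pmf \<Rightarrow> (b3z \<Rightarrow> real) \<Rightarrow> bool" where
  "traffic_equations \<mu> x \<longleftrightarrow> (\<forall>u\<in>Sig.
     x u = pmf \<mu> u * sum x (Next u)
         + (\<Sum>v\<in>Fset u - {u, u \<otimes>\<^bsub>B3Z\<^esub> \<Delta>}. pmf \<mu> v * x (inv\<^bsub>B3Z\<^esub> v \<otimes>\<^bsub>B3Z\<^esub> u))
         + (\<Sum>v\<in>Sig - Fset u. pmf \<mu> v *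
              (x (inv\<^bsub>B3Z\<^esub> v) / sum x (Next (inv\<^bsub>B3Z\<^esub> v)) * x u
               + x (inv\<^bsub>B3Z\<^esub> v \<otimes>\<^bsub>B3Z\<^esub> \<Delta>) / sum x (Next (inv\<^bsub>B3Z\<^esub> v \<otimes>\<^bsub>B3Z\<^esub> \<Delta>)) * x (iota u \<otimes>\<^bsub>B3Z\<^esub> \<Delta>))))"

section \<open>Random walk\<close>

fun conv_pow :: "b3z pmf \<Rightarrow> nat \<Rightarrow> b3z pmf" where
  "conv_pow \<mu> 0 = return_pmf \<one>\<^bsub>B3Z\<^esub>"
| "conv_pow \<mu> (Suc n) = map_pmf (\<lambda>(g, s). g \<otimes>\<^bsub>B3Z\<^esub> s) (pair_pmf (conv_pow \<mu> n) \<mu>)"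

text \<open>The time index of the walk starts at \<open>1\<close>; the values at index \<open>0\<close> are unconstrained.
  The increments take values in the countable set \<open>carrier B3Z\<close> with its discrete
  sigma-algebra, so that their law is given by its point masses.\<close>

definition random_walk ::
  "b3z pmf \<Rightarrow> 'w measure \<Rightarrow> (nat \<Rightarrow> 'w \<Rightarrow> b3z) \<Rightarrow> (nat \<Rightarrow> 'w \<Rightarrow> b3z) \<Rightarrow> bool" where
  "random_walk \<mu> M y Y \<longleftrightarrow>
     prob_space M \<and>
     prob_space.indep_vars M (\<lambda>_. count_space (carrier B3Z)) y {1..} \<and>
     (\<forall>n\<ge>1. \<forall>g\<in>carrier B3Z. measure M {\<omega> \<in> space M. y n \<omega> = g} = pmf \<mu> g) \<and>
     (\<forall>\<omega>\<in>space M. Y 1 \<omega> = \<one>\<^bsub>B3Z\<^esub>) \<and>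
     (\<forall>n\<ge>1. \<forall>\<omega>\<in>space M. Y (Suc n) \<omega> = Y n \<omega> \<otimes>\<^bsub>B3Z\<^esub> y n \<omega>)"

definition reach_prob :: "'w measure \<Rightarrow> (nat \<Rightarrow> 'w \<Rightarrow> b3z) \<Rightarrow> b3z \<Rightarrow> real" where
  "reach_prob M Y u = measure M {\<omega> \<in> space M. \<exists>n\<ge>1. Y n \<omega> = u}"

definition qhat :: "'w measure \<Rightarrow> (nat \<Rightarrow> 'w \<Rightarrow> b3z) \<Rightarrow> b3z \<Rightarrow> real" where
  "qhat M Y u = measure M {\<omega> \<in> space M.
     \<exists>n>1. Y n \<omega> = u \<and> (\<forall>m. 1 < m \<and> m < n \<longrightarrow> Y m \<omega> \<noteq> u \<otimes>\<^bsub>B3Z\<^esub> \<Delta>)}"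

text \<open>Extended nonnegative values: finiteness is not presupposed, it is a consequence
  of an equation between \<open>Green\<close> and the \<open>ennreal\<close> of a real number.\<close>

definition Green :: "b3z pmf \<Rightarrow> b3z \<Rightarrow> ennreal" where
  "Green \<mu> u = (\<Sum>i. ennreal (pmf (conv_pow \<mu> i) u))"

end

theory Submission
  imports Defs
begin

text \<open>The group \<open>B\<^sub>3/Z\<close> is the free product of \<open>\<langle>\<Delta>\<rangle>\<close> (order two) and \<open>\<langle>c\<rangle>\<close> (order three) with
  \<open>c = ab\<close>, and \<open>\<Sigma>\<close> consists of the elements \<open>\<Delta>\<^sup>e c\<^sup>s \<Delta>\<^sup>g\<close> with \<open>s = 1\<close> or \<open>s = -1\<close>. The Traffic
  Equation at \<open>u\<close>, divided by \<open>r(Next u)\<close>, says that the function \<open>H\<close> that sums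
  \<open>q(u\<^sub>1) \<dots> q(u\<^sub>k)\<close> over \<open>\<psi>\<^sup>-\<^sup>1(x)\<close>, with \<open>H(1) = 1\<close> and \<open>H(\<Delta>) = 0\<close>, is harmonic off \<open>{1, \<Delta>}\<close>
  for the walk \<open>x \<mapsto> s\<^sup>-\<^sup>1 x\<close>. Positivity of \<open>r\<close> makes \<open>H\<close> decay geometrically in \<open>k\<close>. The probability
  of visiting a target before its translate by \<open>\<Delta>\<close> is the smallest nonnegative solution of the
  same boundary value problem; hence it lies below \<open>H\<close>, decays as well, and equals \<open>H\<close> by the maximum
  principle. The functions \<open>Q\<close> and \<open>\<Gamma>\<close> are identified in the same way with combinations of
  \<open>H(x)\<close> and \<open>H(x\<Delta>)\<close>, and transience also follows from the maximum principle.\<close>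

section \<open>The quotient as a free product\<close>

text \<open>\<open>Tip f\<close> stands for \<open>\<Delta>\<^sup>f\<close> and \<open>Node e s\<^sub>1 [s\<^sub>2, \<dots>, s\<^sub>k] f\<close> for
  \<open>\<Delta>\<^sup>e c\<^bsup>s1\<^esup> \<Delta> c\<^bsup>s2\<^esup> \<Delta> \<dots> c\<^bsup>sk\<^esup> \<Delta> \<Delta>\<^sup>f\<close>, where a sign \<open>True\<close> means \<open>c\<close> and \<open>False\<close> means \<open>c\<^sup>2\<close>. Note the \<open>\<Delta>\<close>
  in front of \<open>\<Delta>\<^sup>f\<close>. The maps \<open>shift\<close> and \<open>rot\<close> are left multiplication by \<open>\<Delta>\<close> and \<open>c\<close>.\<close>

datatype nf = Tip bool | Node bool bool "bool list" bool

fun shift :: "nf \<Rightarrow> nf" where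
  "shift (Tip f) = Tip (\<not> f)"
| "shift (Node e s ss f) = Node (\<not> e) s ss f"

fun rot :: "nf \<Rightarrow> nf" where
  "rot (Tip f) = Node False True [] (\<not> f)"
| "rot (Node True s ss f) = Node False True (s # ss) f"
| "rot (Node False True ss f) = Node False False ss f"
| "rot (Node False False [] f) = Tip (\<not> f)"
| "rot (Node False False (s # ss) f) = Node True s ss f"

section \<open>Action of words from the left and of \<open>\<Delta>\<close> from the right\<close>

fun flip :: "nf \<Rightarrow> nf" where
  "flip (Tip f) = Tip (\<not> f)"
| "flip (Node e s ss f) = Node e s ss (\<not> f)"

lemma shift_shift [simp]: "shift (shift n) = n"
  by (cases n) auto

lemma rot_rot_rot [simp]: "rot (rot (rot n)) = n"
proof (cases n)
  case (Node e s ss f)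
  then show ?thesis by (cases e; cases s; cases ss; simp)
qed simp

lemma shift_flip: "shift (flip n) = flip (shift n)"
  by (cases n) auto

lemma rot_flip: "rot (flip n) = flip (rot n)"
  by (cases n rule: rot.cases) auto

text \<open>The letters act through \<open>a = c^2 \<Delta>\<close> and
  \<open>b = \<Delta> c^2\<close>, with inverses \<open>\<Delta> c\<close> and
  \<open>c \<Delta>\<close>.\<close>

fun act_letter :: "gen \<times> bool \<Rightarrow> nf \<Rightarrow> nf" where
  "act_letter (GA, True) n = rot (rot (shift n))"
| "act_letter (GA, False) n = shift (rot n)"
| "act_letter (GB, True) n = shift (rot (rot n))"
| "act_letter (GB, False) n = rot (shift n)"

definition act :: "word \<Rightarrow> nf \<Rightarrow> nf" where
  "act w n = foldr act_letter w n"

lemma act_simps [simp]: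
  "act [] n = n" "act (l # w) n = act_letter l (act w n)" "act (v @ w) n = act v (act w n)"
  by (simp_all add: act_def)

lemma act_letter_cancel: "act_letter (x, e) (act_letter (x, \<not> e) n) = n"
  by (cases x; cases e) auto

text \<open>Opposite letters undo each other, and \<open>aba\<close> and \<open>bab\<close> both act
  as \<open>shift\<close>, since the powers of \<open>c\<close> that meet add up to
  \<open>c^6\<close>.\<close>

lemma act_braid_eq: "braid_eq v w \<Longrightarrow> act v n = act w n"
  by (induction arbitrary: n rule: braid_eq.induct) (auto simp: act_letter_cancel)

lemma act_flip: "act w (flip n) = flip (act w n)"
proof (induction w)
  case (Cons l w)
  have "act_letter l (flip m) = flip (act_letter l m)" for m
    by (cases "(l, m)" rule: act_letter.cases) (auto simp: shift_flip rot_flip)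
  with Cons show ?case by simp
qed simp

section \<open>Cosets of words and the code of a group element\<close>

definition cls :: "word \<Rightarrow> b3z" where
  "cls w = ZB #>\<^bsub>B3\<^esub> braid_class w"

interpretation B3: group B3 by (rule group_B3)
interpretation Z: group B3Z by (rule group_B3Z)

lemma carrier_B3Z: "carrier B3Z = range cls"
  by (auto simp: B3Z_def FactGroup_def RCOSETS_def cls_def carrier_B3)

lemma cls_closed [simp]: "cls w \<in> carrier B3Z"
  by (simp add: carrier_B3Z)

lemma cls_mult: "cls v \<otimes>\<^bsub>B3Z\<^esub> cls w = cls (v @ w)"
  using normal.rcos_sum[OF normal_Z, of "braid_class v" "braid_class w"]
  by (simp add: B3Z_def FactGroup_def cls_def carrier_B3 mult_B3)

lemma ZB_subgroup: "subgroup ZB B3"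
  using normal_Z by (rule normal_imp_subgroup)

lemma cls_Nil: "cls [] = \<one>\<^bsub>B3Z\<^esub>"
  using B3.coset_mult_one[OF subgroup.subset[OF ZB_subgroup]]
  by (simp add: B3Z_def FactGroup_def cls_def flip: one_B3)

text \<open>\<open>\<Delta>^2\<close> acts as \<open>shift\<close> applied twice, which is the
  identity; this lets the action descend to the quotient.\<close>

lemma ZB_act:
  assumes "X \<in> ZB"
  shows "\<exists>w. X = braid_class w \<and> act w = id"
  using assms unfolding ZB_def
proof (induction rule: generate.induct)
  case one
  show ?case by (intro exI[of _ "[]"]) (auto simp: one_B3)
next
  case (incl h)
  then show ?case
    by (intro exI[of _ "[(GA, True), (GB, True), (GA, True), (GA, True), (GB, True), (GA, True)]"])
      (auto simp: \<Delta>0_eq mult_B3)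
next
  case (inv h)
  define w where "w = [(GA, True), (GB, True), (GA, True), (GA, True), (GB, True), (GA, True)]"
  have h: "h = braid_class w" using inv by (simp add: \<Delta>0_eq mult_B3 w_def)
  have w: "act w n = n" for n by (simp add: w_def)
  obtain v where v: "braid_eq (v @ w) []" using braid_eq_inverse by blast
  have "inv\<^bsub>B3\<^esub> h = braid_class v"
    using v by (intro B3.inv_equality)
      (auto simp: h mult_B3 one_B3 braid_class_eq_iff carrier_B3)
  moreover have "act v = id"
    using act_braid_eq[OF v] by (auto simp: w)
  ultimately show ?case by blast
next
  case (eng h1 h2)
  then obtain v w where "h1 = braid_class v" "act v = id" "h2 = braid_class w" "act w = id"
    by blast
  then show ?case by (intro exI[of _ "v @ w"]) (auto simp: mult_B3)
qed

lemma act_cls_eq: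
  assumes "cls v = cls w"
  shows "act v n = act w n"
proof -
  have "braid_class v \<in> ZB #>\<^bsub>B3\<^esub> braid_class w"
    using B3.rcos_self[OF _ ZB_subgroup, of "braid_class v"] assms by (simp add: cls_def carrier_B3)
  then obtain z where z: "z \<in> ZB" "braid_class v = z \<otimes>\<^bsub>B3\<^esub> braid_class w"
    by (auto simp: r_coset_def)
  from ZB_act[OF z(1)] obtain u where "z = braid_class u" "act u = id" by blast
  with z have "braid_eq v (u @ w)" by (simp add: mult_B3 braid_class_eq_iff)
  with \<open>act u = id\<close> show ?thesis using act_braid_eq by fastforce
qed

text \<open>The orbit map at the trivial normal form; by \<open>act_cls_eq\<close> it does not
  depend on the chosen word.\<close>

definition code :: "b3z \<Rightarrow> nf" where
  "code x = act (SOME w. cls w = x) (Tip False)"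

lemma code_cls: "code (cls w) = act w (Tip False)"
  unfolding code_def by (rule act_cls_eq) (metis (mono_tags) someI)

lemma code_cls_mult: "x \<in> carrier B3Z \<Longrightarrow> code (cls v \<otimes>\<^bsub>B3Z\<^esub> x) = act v (code x)"
  by (auto simp: carrier_B3Z cls_mult code_cls)

abbreviation cZ where "cZ \<equiv> aZ \<otimes>\<^bsub>B3Z\<^esub> bZ"

section \<open>Relations between \<open>a\<close>, \<open>b\<close>, \<open>c\<close> and
  \<open>\<Delta>\<close> in the quotient\<close>

lemma cls_gens:
  "aZ = cls [(GA, True)]" "bZ = cls [(GB, True)]" "\<Delta> = cls [(GA, True), (GB, True), (GA, True)]"
  by (simp_all add: aZ_def bZ_def a0_def b0_def \<Delta>_def cls_def \<Delta>0_eq)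

lemma gens_closed [simp]: "aZ \<in> carrier B3Z" "bZ \<in> carrier B3Z" "\<Delta> \<in> carrier B3Z"
  by (simp_all add: cls_gens)

lemma Delta_aba: "\<Delta> = aZ \<otimes>\<^bsub>B3Z\<^esub> bZ \<otimes>\<^bsub>B3Z\<^esub> aZ"
  by (simp add: cls_gens cls_mult)

lemma Delta_bab: "\<Delta> = bZ \<otimes>\<^bsub>B3Z\<^esub> aZ \<otimes>\<^bsub>B3Z\<^esub> bZ"
proof -
  have "braid_class [(GA, True), (GB, True), (GA, True)] = braid_class [(GB, True), (GA, True), (GB, True)]"
    using braid_eq.braid[of "[]" "[]"] by (simp add: braid_class_eq_iff)
  then show ?thesis by (simp add: cls_gens cls_mult) (simp add: cls_def)
qed

lemma Delta_Delta [simp]: "\<Delta> \<otimes>\<^bsub>B3Z\<^esub> \<Delta> = \<one>\<^bsub>B3Z\<^esub>"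
proof -
  have "\<Delta>0 \<otimes>\<^bsub>B3\<^esub> \<Delta>0 \<in> ZB"
    unfolding ZB_def by (rule generate.incl) simp
  then have "cls ([(GA, True), (GB, True), (GA, True)] @ [(GA, True), (GB, True), (GA, True)]) = ZB"
    unfolding cls_def
    by (subst B3.coset_join2) (auto simp: \<Delta>0_eq mult_B3 carrier_B3 ZB_subgroup)
  then show ?thesis
    unfolding cls_gens cls_mult by (simp add: B3Z_def FactGroup_def)
qed

lemma Delta_cancel [simp]: "x \<in> carrier B3Z \<Longrightarrow> \<Delta> \<otimes>\<^bsub>B3Z\<^esub> (\<Delta> \<otimes>\<^bsub>B3Z\<^esub> x) = x"
  by (simp flip: Z.m_assoc)

lemma Delta_inv [simp]: "inv\<^bsub>B3Z\<^esub> \<Delta> = \<Delta>"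
  by (rule Z.inv_equality) auto

lemma bZ_eq: "bZ = \<Delta> \<otimes>\<^bsub>B3Z\<^esub> (cZ \<otimes>\<^bsub>B3Z\<^esub> cZ)"
proof -
  have "\<Delta> \<otimes>\<^bsub>B3Z\<^esub> bZ = cZ \<otimes>\<^bsub>B3Z\<^esub> cZ"
    unfolding Delta_aba by (simp add: Z.m_assoc)
  then have "\<Delta> \<otimes>\<^bsub>B3Z\<^esub> (cZ \<otimes>\<^bsub>B3Z\<^esub> cZ) = \<Delta> \<otimes>\<^bsub>B3Z\<^esub> (\<Delta> \<otimes>\<^bsub>B3Z\<^esub> bZ)" by simp
  then show ?thesis by simp
qed

text \<open>Regroup \<open>(ab)^3\<close> as \<open>aba\<close> times \<open>bab\<close>, which is
  \<open>\<Delta>^2 = 1\<close>.\<close>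

lemma ccc: "cZ \<otimes>\<^bsub>B3Z\<^esub> (cZ \<otimes>\<^bsub>B3Z\<^esub> cZ) = \<one>\<^bsub>B3Z\<^esub>"
proof -
  have "cZ \<otimes>\<^bsub>B3Z\<^esub> (cZ \<otimes>\<^bsub>B3Z\<^esub> cZ)
      = (aZ \<otimes>\<^bsub>B3Z\<^esub> bZ \<otimes>\<^bsub>B3Z\<^esub> aZ) \<otimes>\<^bsub>B3Z\<^esub> (bZ \<otimes>\<^bsub>B3Z\<^esub> aZ \<otimes>\<^bsub>B3Z\<^esub> bZ)"
    by (simp add: Z.m_assoc)
  then show ?thesis by (simp flip: Delta_aba Delta_bab)
qed

lemma aZ_eq: "aZ = cZ \<otimes>\<^bsub>B3Z\<^esub> (cZ \<otimes>\<^bsub>B3Z\<^esub> \<Delta>)"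
proof -
  have "cZ \<otimes>\<^bsub>B3Z\<^esub> (cZ \<otimes>\<^bsub>B3Z\<^esub> (cZ \<otimes>\<^bsub>B3Z\<^esub> aZ)) = aZ"
    using ccc by (simp flip: Z.m_assoc)
  then show ?thesis by (simp add: Delta_aba)
qed

lemma code_one [simp]: "code \<one>\<^bsub>B3Z\<^esub> = Tip False"
  using code_cls[of "[]"] by (simp add: cls_Nil)

lemma code_mult_Delta [simp]: "x \<in> carrier B3Z \<Longrightarrow> code (\<Delta> \<otimes>\<^bsub>B3Z\<^esub> x) = shift (code x)"
  by (simp add: cls_gens code_cls_mult)

lemma code_mult_c [simp]: "x \<in> carrier B3Z \<Longrightarrow> code (cZ \<otimes>\<^bsub>B3Z\<^esub> x) = rot (code x)"
  by (simp add: cls_gens code_cls_mult cls_mult)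

lemma code_mult_right_Delta [simp]: "x \<in> carrier B3Z \<Longrightarrow> code (x \<otimes>\<^bsub>B3Z\<^esub> \<Delta>) = flip (code x)"
proof -
  assume "x \<in> carrier B3Z"
  then obtain w where "x = cls w" by (auto simp: carrier_B3Z)
  moreover have "shift (Tip False) = flip (Tip False)" by simp
  ultimately show ?thesis
    by (simp add: cls_gens cls_mult code_cls flip: act_flip)
qed

section \<open>Decoding normal forms\<close>

definition dpow :: "bool \<Rightarrow> b3z" where
  "dpow e = (if e then \<Delta> else \<one>\<^bsub>B3Z\<^esub>)"

definition cpow :: "bool \<Rightarrow> b3z" where
  "cpow s = (if s then cZ else cZ \<otimes>\<^bsub>B3Z\<^esub> cZ)"

lemma dpow_closed [simp]: "dpow e \<in> carrier B3Z" and cpow_closed [simp]: "cpow e \<in> carrier B3Z"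
  by (simp_all add: dpow_def cpow_def)

fun chain :: "bool list \<Rightarrow> bool \<Rightarrow> b3z" where
  "chain [] f = dpow f"
| "chain (s # ss) f = cpow s \<otimes>\<^bsub>B3Z\<^esub> (\<Delta> \<otimes>\<^bsub>B3Z\<^esub> chain ss f)"

lemma chain_closed [simp]: "chain ss f \<in> carrier B3Z"
  by (induction ss) auto

fun decode :: "nf \<Rightarrow> b3z" where
  "decode (Tip f) = dpow f"
| "decode (Node e s ss f) = dpow e \<otimes>\<^bsub>B3Z\<^esub> chain (s # ss) f"

lemma decode_closed [simp]: "decode n \<in> carrier B3Z"
  by (cases n) auto

lemma c_cancel: "x \<in> carrier B3Z \<Longrightarrow> cZ \<otimes>\<^bsub>B3Z\<^esub> (cZ \<otimes>\<^bsub>B3Z\<^esub> (cZ \<otimes>\<^bsub>B3Z\<^esub> x)) = x"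
  using ccc by (simp flip: Z.m_assoc)

lemma decode_shift: "decode (shift n) = \<Delta> \<otimes>\<^bsub>B3Z\<^esub> decode n"
  by (cases n) (auto simp: dpow_def)

lemma decode_rot: "decode (rot n) = cZ \<otimes>\<^bsub>B3Z\<^esub> decode n"
proof (cases n rule: rot.cases)
  case (1 f)
  then show ?thesis by (simp add: dpow_def cpow_def)
next
  case (3 ss f)
  then show ?thesis
    using Z.m_assoc[of cZ cZ "\<Delta> \<otimes>\<^bsub>B3Z\<^esub> chain ss f"] by (simp add: dpow_def cpow_def)
next
  case (4 f)
  have "cZ \<otimes>\<^bsub>B3Z\<^esub> ((cZ \<otimes>\<^bsub>B3Z\<^esub> cZ) \<otimes>\<^bsub>B3Z\<^esub> x) = x" if "x \<in> carrier B3Z" for x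
    using that c_cancel[of x] Z.m_assoc[of cZ cZ x] by simp
  then show ?thesis using 4 by (simp add: dpow_def cpow_def)
next
  case (5 s ss f)
  have "cZ \<otimes>\<^bsub>B3Z\<^esub> ((cZ \<otimes>\<^bsub>B3Z\<^esub> cZ) \<otimes>\<^bsub>B3Z\<^esub> x) = x" if "x \<in> carrier B3Z" for x
    using that c_cancel[of x] Z.m_assoc[of cZ cZ x] by simp
  then show ?thesis using 5 by (simp add: dpow_def cpow_def)
qed (simp_all add: dpow_def cpow_def)

text \<open>Equivariance of \<open>decode\<close>; evaluated at \<open>Tip False\<close> it makes
  \<open>decode\<close> a left inverse of \<open>code\<close>.\<close>

lemma decode_act: "decode (act w n) = cls w \<otimes>\<^bsub>B3Z\<^esub> decode n"
proof (induction w)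
  case (Cons l w)
  have a: "aZ \<otimes>\<^bsub>B3Z\<^esub> decode m = decode (act_letter (GA, True) m)" for m
    by (subst aZ_eq) (simp add: decode_rot decode_shift Z.m_assoc)
  have b: "bZ \<otimes>\<^bsub>B3Z\<^esub> decode m = decode (act_letter (GB, True) m)" for m
    by (subst bZ_eq) (simp add: decode_rot decode_shift Z.m_assoc)
  have *: "cls [(x, False)] \<otimes>\<^bsub>B3Z\<^esub> (cls [(x, True)] \<otimes>\<^bsub>B3Z\<^esub> z) = z" if "z \<in> carrier B3Z" for x z
  proof -
    have "braid_class [(x, False), (x, True)] = braid_class []"
      using braid_eq.cancel[of "[]" x False "[]"] by (simp add: braid_class_eq_iff)
    then have "cls [(x, False), (x, True)] = \<one>\<^bsub>B3Z\<^esub>"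
      by (simp add: cls_def flip: cls_Nil)
    then show ?thesis using that by (simp add: cls_mult flip: Z.m_assoc)
  qed
  have "decode (act_letter l m) = cls [l] \<otimes>\<^bsub>B3Z\<^esub> decode m" for m
  proof -
    obtain x e where l: "l = (x, e)" by force
    show ?thesis
    proof (cases e)
      case True
      then show ?thesis using a b by (cases x) (simp_all add: l cls_gens)
    next
      case False
      \<comment> \<open>An inverse letter is treated by applying the positive letter to its result
        and cancelling.\<close>
      let ?m = "act_letter (x, False) m"
      have "decode m = cls [(x, True)] \<otimes>\<^bsub>B3Z\<^esub> decode ?m"
        using act_letter_cancel[of x True m] a[of ?m] b[of ?m]
        by (cases x) (simp_all add: cls_gens)
      then show ?thesis using False * by (simp add: l)
    qed
  qed
  with Cons show ?case by (simp add: cls_mult flip: Z.m_assoc)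
qed (simp add: cls_Nil)

lemma decode_code: "x \<in> carrier B3Z \<Longrightarrow> decode (code x) = x"
  by (auto simp: carrier_B3Z code_cls decode_act dpow_def)

lemma code_inject: "x \<in> carrier B3Z \<Longrightarrow> y \<in> carrier B3Z \<Longrightarrow> code x = code y \<longleftrightarrow> x = y"
  by (metis decode_code)

lemma code_eqI: "code x = code y \<Longrightarrow> x \<in> carrier B3Z \<Longrightarrow> y \<in> carrier B3Z \<Longrightarrow> x = y"
  by (simp add: code_inject)

text \<open>Admits an empty sign list, where only the product \<open>\<Delta>^e \<Delta>^f\<close>
  counts; \<open>shift\<close>, \<open>rot\<close> and \<open>flip\<close> then act on sign lists
  without a separate \<open>Tip\<close> case.\<close>

fun mk :: "bool \<Rightarrow> bool list \<Rightarrow> bool \<Rightarrow> nf" where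
  "mk e [] f = Tip (e \<noteq> f)"
| "mk e (s # ss) f = Node e s ss f"

lemma mk_eq_iff: "mk e ss f = mk e' ss' f' \<longleftrightarrow>
    ss = ss' \<and> (if ss = [] then (e \<noteq> f) = (e' \<noteq> f') else e = e' \<and> f = f')"
  by (cases ss; cases ss') auto

lemma mk_exhaust: "\<exists>e ss f. n = mk e ss f"
proof (cases n)
  case (Tip f)
  then have "n = mk False [] f" by simp
  then show ?thesis by blast
next
  case (Node e s ss f)
  then have "n = mk e (s # ss) f" by simp
  then show ?thesis by blast
qed

lemma shift_mk [simp]: "shift (mk e ss f) = mk (\<not> e) ss f"
  by (cases ss) auto

lemma flip_mk [simp]: "flip (mk e ss f) = mk e ss (\<not> f)"
  by (cases ss) auto

lemma rot_mk [simp]: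
  "rot (mk True ss f) = mk False (True # ss) f"
  "rot (mk False (True # ss) f) = mk False (False # ss) f"
  "rot (mk False (False # ss) f) = mk True ss f"
  by (cases ss; simp)+

section \<open>Coordinates on \<open>\<Sigma>\<close>\<close>

definition elt :: "bool \<Rightarrow> bool \<Rightarrow> bool \<Rightarrow> b3z" where
  "elt e s g = dpow e \<otimes>\<^bsub>B3Z\<^esub> (cpow s \<otimes>\<^bsub>B3Z\<^esub> dpow g)"

lemma elt_closed [simp]: "elt e s g \<in> carrier B3Z"
  by (simp add: elt_def)

lemma code_cpow: "x \<in> carrier B3Z \<Longrightarrow> code (cpow s \<otimes>\<^bsub>B3Z\<^esub> x) = (if s then rot (code x) else rot (rot (code x)))"
  using Z.m_assoc[of cZ cZ x] by (simp add: cpow_def)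

lemma code_dpow: "x \<in> carrier B3Z \<Longrightarrow> code (dpow e \<otimes>\<^bsub>B3Z\<^esub> x) = (if e then shift (code x) else code x)"
  by (simp add: dpow_def)

lemma code_elt_mult:
  assumes "x \<in> carrier B3Z"
  shows "code (elt e s g \<otimes>\<^bsub>B3Z\<^esub> x) =
    (let n = (if g then shift (code x) else code x); m = (if s then rot n else rot (rot n))
     in if e then shift m else m)"
proof -
  have "elt e s g \<otimes>\<^bsub>B3Z\<^esub> x = dpow e \<otimes>\<^bsub>B3Z\<^esub> (cpow s \<otimes>\<^bsub>B3Z\<^esub> (dpow g \<otimes>\<^bsub>B3Z\<^esub> x))"
    using assms by (simp add: elt_def Z.m_assoc)
  then show ?thesis using assms by (simp add: code_dpow code_cpow Let_def)
qed

text \<open>The negation of \<open>g\<close> compensates for the \<open>\<Delta>\<close> that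
  \<open>Node\<close> puts in front of \<open>\<Delta>^f\<close>.\<close>

lemma code_elt [simp]: "code (elt e s g) = mk e [s] (\<not> g)"
proof -
  have "code (elt e s g) = code (elt e s g \<otimes>\<^bsub>B3Z\<^esub> \<one>\<^bsub>B3Z\<^esub>)" by simp
  also have "\<dots> = mk e [s] (\<not> g)"
    by (subst code_elt_mult) (auto simp: Let_def)
  finally show ?thesis .
qed

lemma code_decode: "code (decode n) = n"
proof -
  have ch: "code (chain ss f) = mk False ss f" for ss f
  proof (induction ss)
    case Nil
    show ?case by (cases f) (auto simp: dpow_def code_cls cls_gens)
  next
    case (Cons s ss)
    then show ?case by (simp add: code_cpow del: mk.simps)
  qed
  show ?thesis
  proof (cases n)
    case (Tip f)
    then show ?thesis using ch[of "[]" f] by simp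
  next
    case (Node e s ss f)
    then show ?thesis using ch[of "s # ss" f] by (simp add: code_dpow)
  qed
qed

text \<open>For \<open>g \<noteq> e\<close> one \<open>\<Delta>\<close> survives between the powers
  of \<open>c\<close>, so the sign list grows. For \<open>g = e\<close> the powers merge: equal
  signs give the opposite sign because \<open>c\<close> has order three; opposite signs cancel, and
  the \<open>\<Delta>\<close> behind them joins \<open>\<Delta>^d\<close>.\<close>

lemma elt_mult_mk:
  assumes "x \<in> carrier B3Z" "code x = mk e ss f"
  shows "g \<noteq> e \<Longrightarrow> code (elt d s g \<otimes>\<^bsub>B3Z\<^esub> x) = mk d (s # ss) f"
    and "g = e \<Longrightarrow> ss = t # ss' \<Longrightarrow> code (elt d s g \<otimes>\<^bsub>B3Z\<^esub> x) = (if s = t then mk d ((\<not> s) # ss') f else mk (\<not> d) ss' f)"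
  using assms by (auto simp: code_elt_mult Let_def simp del: mk.simps)

lemma code_Delta [simp]: "code \<Delta> = Tip True"
  using code_mult_Delta[of "\<one>\<^bsub>B3Z\<^esub>"] by simp

lemma elt_inject [simp]: "elt e s g = elt e' s' g' \<longleftrightarrow> e = e' \<and> s = s' \<and> g = g'"
  using code_inject[of "elt e s g" "elt e' s' g'"] by auto

lemma elt_mult_Delta [simp]: "elt e s g \<otimes>\<^bsub>B3Z\<^esub> \<Delta> = elt e s (\<not> g)"
  using code_inject[of "elt e s g \<otimes>\<^bsub>B3Z\<^esub> \<Delta>" "elt e s (\<not> g)"] by simp

lemma Delta_mult_elt [simp]: "\<Delta> \<otimes>\<^bsub>B3Z\<^esub> elt e s g = elt (\<not> e) s g"
  using code_inject[of "\<Delta> \<otimes>\<^bsub>B3Z\<^esub> elt e s g" "elt (\<not> e) s g"] by simp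

lemma elt_inv [simp]: "inv\<^bsub>B3Z\<^esub> elt e s g = elt g (\<not> s) e"
proof (rule Z.inv_equality)
  have "code (elt g (\<not> s) e \<otimes>\<^bsub>B3Z\<^esub> elt e s g) = code \<one>\<^bsub>B3Z\<^esub>"
    by (subst elt_mult_mk(2)[where f = "\<not> g" and ss' = "[]"]) auto
  then show "elt g (\<not> s) e \<otimes>\<^bsub>B3Z\<^esub> elt e s g = \<one>\<^bsub>B3Z\<^esub>"
    by (rule code_eqI) auto
qed auto

lemma gens_elt:
  "aZ = elt False False True" "bZ = elt True False False"
  "aZ \<otimes>\<^bsub>B3Z\<^esub> bZ = elt False True False" "bZ \<otimes>\<^bsub>B3Z\<^esub> aZ = elt True True True"
proof -
  show 1: "aZ = elt False False True" by (subst aZ_eq) (simp add: elt_def dpow_def cpow_def Z.m_assoc)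
  show 2: "bZ = elt True False False" by (subst bZ_eq) (simp add: elt_def dpow_def cpow_def Z.m_assoc)
  show "aZ \<otimes>\<^bsub>B3Z\<^esub> bZ = elt False True False" by (simp add: elt_def dpow_def cpow_def)
  have "code (elt True False False \<otimes>\<^bsub>B3Z\<^esub> elt False False True) = code (elt True True True)"
    by (subst elt_mult_mk(2)[where f = False and ss' = "[]"]) auto
  then show "bZ \<otimes>\<^bsub>B3Z\<^esub> aZ = elt True True True"
    unfolding 1 2 by (rule code_eqI) auto
qed

lemma Tset_elt: "Tset = {elt e s (e = s) | e s. True}"
  unfolding Tset_def gens_elt(3,4) unfolding gens_elt(1,2) by (auto simp: ex_bool_eq)

lemma elt_Tset [simp]: "elt e s g \<in> Tset \<longleftrightarrow> g = (e = s)"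
  by (auto simp: Tset_elt)

lemma Sig_elt: "Sig = (\<lambda>(e, s, g). elt e s g) ` UNIV"
proof (intro Set.equalityI subsetI)
  fix u assume "u \<in> Sig"
  then show "u \<in> (\<lambda>(e, s, g). elt e s g) ` UNIV"
    by (auto simp: Sig_def Tset_elt image_iff split_paired_Ex)
next
  fix u assume "u \<in> (\<lambda>(e, s, g). elt e s g) ` UNIV"
  then obtain e s g where u: "u = elt e s g" by auto
  show "u \<in> Sig"
  proof (cases "g = (e = s)")
    case True
    then show ?thesis by (simp add: Sig_def u)
  next
    case False
    then have "elt e s (\<not> g) \<in> Tset" "u = elt e s (\<not> g) \<otimes>\<^bsub>B3Z\<^esub> \<Delta>" by (auto simp: u)
    then show ?thesis unfolding Sig_def by blast
  qed
qed

lemma elt_Sig [simp]: "elt e s g \<in> Sig"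
  by (auto simp: Sig_elt)

lemma SigE: 
  assumes "u \<in> Sig" obtains e s g where "u = elt e s g"
  using assms by (auto simp: Sig_elt)

lemma Sig_closed: "u \<in> Sig \<Longrightarrow> u \<in> carrier B3Z"
  by (auto elim: SigE)

lemma Sig_inv: "u \<in> Sig \<Longrightarrow> inv\<^bsub>B3Z\<^esub> u \<in> Sig"
  by (auto elim!: SigE)

lemma finite_Sig [simp]: "finite Sig"
  by (simp add: Sig_elt)

lemma First_elt [simp]: "First (elt e s g) = (if e then bZ else aZ)"
  unfolding First_def FirstT_def gens_elt(3,4) unfolding gens_elt(1,2) by auto

lemma iota_elt [simp]: "iota (elt e s g) = elt (\<not> e) s (\<not> g)"
  by (simp add: iota_def)

lemma Last_elt [simp]: "Last (elt e s g) = (if g then aZ else bZ)"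
  unfolding Last_def LastT_def gens_elt(3,4) unfolding gens_elt(1,2) by auto

lemma aZ_neq_bZ [simp]: "aZ \<noteq> bZ" "bZ \<noteq> aZ"
  by (simp_all add: gens_elt)

text \<open>The leading exponent encodes the first letter and the trailing exponent the last one.
  Admissible neighbours have exponents \<open>g\<close> and \<open>\<not> g\<close>, so exactly one
  \<open>\<Delta>\<close> stays between them and their product does not reduce.\<close>

lemma Next_elt: "Next (elt e s g) = (\<lambda>(t, h). elt (\<not> g) t h) ` UNIV"
  unfolding Next_def by (auto elim!: SigE simp: image_iff split: if_splits)

lemma elt_Next [simp]: "elt e' s' g' \<in> Next (elt e s g) \<longleftrightarrow> e' = (\<not> g)"
  by (auto simp: Next_elt)

lemma Fset_elt: "Fset (elt e s g) = (\<lambda>(t, h). elt e t h) ` UNIV"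
  unfolding Fset_def by (auto elim!: SigE simp: image_iff split: if_splits)

lemma sum_Sig: "sum h Sig = (\<Sum>e\<in>UNIV. \<Sum>s\<in>UNIV. \<Sum>g\<in>UNIV. h (elt e s g))"
  unfolding Sig_elt
  by (subst sum.reindex) (auto simp: inj_on_def sum.cartesian_product UNIV_Times_UNIV case_prod_unfold)

lemma sum_Next: "sum h (Next (elt e s g)) = (\<Sum>t\<in>UNIV. \<Sum>k\<in>UNIV. h (elt (\<not> g) t k))"
  unfolding Next_elt
  by (subst sum.reindex) (auto simp: inj_on_def sum.cartesian_product UNIV_Times_UNIV case_prod_unfold)

text \<open>Sign lists can be arbitrarily long. This keeps positive constants from decaying, which
  closes the maximum principle.\<close>

lemma infinite_carrier: "infinite (carrier B3Z)"
proof
  assume "finite (carrier B3Z)"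
  moreover have "code ` carrier B3Z = UNIV"
    using code_decode by (metis decode_closed surjI[of code] image_eqI UNIV_eq_I)
  ultimately have "finite (UNIV :: nf set)" by (metis finite_imageI)
  moreover have "inj (\<lambda>n. Node False True (replicate n True) False)"
    by (auto simp: inj_on_def)
  ultimately show False
    using finite_UNIV_inj_surj infinite_UNIV_nat by (metis finite_imageD finite_subset subset_UNIV)
qed

text \<open>Lets events about finitely many increments be split into countably many point
  events.\<close>

lemma countable_carrier: "countable (carrier B3Z)"
proof -
  have "countable (UNIV :: word set)"
  proof -
    have "finite (UNIV :: gen set)"
      by (rule finite_subset[of _ "{GA, GB}"]) (auto intro: gen.exhaust)
    then have "finite (UNIV :: (gen \<times> bool) set)"
      by (simp add: finite_prod)
    then have "countable (lists (UNIV :: (gen \<times> bool) set))"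
      by (intro countable_lists countable_finite)
    then show ?thesis by simp
  qed
  then show ?thesis by (simp add: carrier_B3Z)
qed

section \<open>Laws of the random walk\<close>

lemma conv_pow_closed:
  assumes "set_pmf \<mu> \<subseteq> carrier B3Z"
  shows "set_pmf (conv_pow \<mu> n) \<subseteq> carrier B3Z"
  using assms by (induction n) auto

text \<open>\<open>conv_pow\<close> adds increments on the right, whereas harmonicity conditions on
  the first increment; associativity exchanges the two.\<close>

lemma conv_pow_Suc_left:
  assumes \<mu>: "set_pmf \<mu> \<subseteq> carrier B3Z"
  shows "conv_pow \<mu> (Suc n) = bind_pmf \<mu> (\<lambda>s. map_pmf (\<lambda>g. s \<otimes>\<^bsub>B3Z\<^esub> g) (conv_pow \<mu> n))"
proof (induction n)
  case 0
  have "map_pmf (\<lambda>s. \<one>\<^bsub>B3Z\<^esub> \<otimes>\<^bsub>B3Z\<^esub> s) \<mu> = map_pmf (\<lambda>s. s \<otimes>\<^bsub>B3Z\<^esub> \<one>\<^bsub>B3Z\<^esub>) \<mu>"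
    using \<mu> by (intro map_pmf_cong) auto
  then show ?case
    by (simp add: pair_pmf_def map_bind_pmf bind_return_pmf map_pmf_def bind_assoc_pmf)
next
  case (Suc n)
  have "conv_pow \<mu> (Suc (Suc n)) = bind_pmf (conv_pow \<mu> (Suc n)) (\<lambda>g. map_pmf (\<lambda>s. g \<otimes>\<^bsub>B3Z\<^esub> s) \<mu>)"
    by (subst conv_pow.simps) (simp add: pair_pmf_def map_bind_pmf bind_return_pmf map_pmf_def bind_assoc_pmf)
  also have "\<dots> = bind_pmf \<mu> (\<lambda>t. bind_pmf (conv_pow \<mu> n) (\<lambda>h. map_pmf (\<lambda>s. t \<otimes>\<^bsub>B3Z\<^esub> h \<otimes>\<^bsub>B3Z\<^esub> s) \<mu>))"
    unfolding Suc by (simp add: bind_assoc_pmf bind_map_pmf)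
  also have "\<dots> = bind_pmf \<mu> (\<lambda>t. bind_pmf (conv_pow \<mu> n) (\<lambda>h. map_pmf (\<lambda>s. t \<otimes>\<^bsub>B3Z\<^esub> (h \<otimes>\<^bsub>B3Z\<^esub> s)) \<mu>))"
    using \<mu> conv_pow_closed[OF \<mu>, of n]
    by (intro bind_pmf_cong map_pmf_cong HOL.refl) (auto simp: Z.m_assoc subset_iff)
  also have "\<dots> = bind_pmf \<mu> (\<lambda>t. map_pmf (\<lambda>g. t \<otimes>\<^bsub>B3Z\<^esub> g) (conv_pow \<mu> (Suc n)))"
    by (simp add: pair_pmf_def map_bind_pmf bind_return_pmf map_pmf_def bind_assoc_pmf)
  finally show ?case .
qed

lemma pmf_map_left_mult:
  assumes "set_pmf p \<subseteq> carrier B3Z" "s \<in> carrier B3Z" "x \<in> carrier B3Z"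
  shows "pmf (map_pmf (\<lambda>g. s \<otimes>\<^bsub>B3Z\<^esub> g) p) x = pmf p (inv\<^bsub>B3Z\<^esub> s \<otimes>\<^bsub>B3Z\<^esub> x)"
proof -
  have eq: "s \<otimes>\<^bsub>B3Z\<^esub> g = x \<longleftrightarrow> g = inv\<^bsub>B3Z\<^esub> s \<otimes>\<^bsub>B3Z\<^esub> x" if "g \<in> carrier B3Z" for g
    using that assms(2,3) by (metis Z.inv_solve_left)
  have "pmf (map_pmf (\<lambda>g. s \<otimes>\<^bsub>B3Z\<^esub> g) p) x = measure p ((\<lambda>g. s \<otimes>\<^bsub>B3Z\<^esub> g) -` {x})"
    by (rule pmf_map)
  also have "\<dots> = measure p {inv\<^bsub>B3Z\<^esub> s \<otimes>\<^bsub>B3Z\<^esub> x}"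
  proof (rule measure_prob_cong_0)
    fix g assume "g \<in> (\<lambda>g. s \<otimes>\<^bsub>B3Z\<^esub> g) -` {x} - {inv\<^bsub>B3Z\<^esub> s \<otimes>\<^bsub>B3Z\<^esub> x}"
    then show "pmf p g = 0" using eq assms(1) by (auto simp: set_pmf_iff subset_iff)
  next
    fix g assume "g \<in> {inv\<^bsub>B3Z\<^esub> s \<otimes>\<^bsub>B3Z\<^esub> x} - (\<lambda>g. s \<otimes>\<^bsub>B3Z\<^esub> g) -` {x}"
    then show "pmf p g = 0" using eq assms(2,3) by auto
  qed
  finally show ?thesis by (simp add: measure_pmf_single)
qed

lemma inv_mult_eq_iff:
  assumes "g \<in> carrier B3Z" "u \<in> carrier B3Z" "k \<in> carrier B3Z"
  shows "inv\<^bsub>B3Z\<^esub> g \<otimes>\<^bsub>B3Z\<^esub> u = k \<longleftrightarrow> g = u \<otimes>\<^bsub>B3Z\<^esub> inv\<^bsub>B3Z\<^esub> k"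
proof -
  have "inv\<^bsub>B3Z\<^esub> g \<otimes>\<^bsub>B3Z\<^esub> u = k \<longleftrightarrow> u = g \<otimes>\<^bsub>B3Z\<^esub> k"
    using assms by (metis Z.inv_closed Z.inv_solve_left)
  also have "\<dots> \<longleftrightarrow> g = u \<otimes>\<^bsub>B3Z\<^esub> inv\<^bsub>B3Z\<^esub> k"
    using assms by (metis Z.inv_solve_right)
  finally show ?thesis .
qed

lemma inv_mult_eq_one:
  "g \<in> carrier B3Z \<Longrightarrow> u \<in> carrier B3Z \<Longrightarrow> inv\<^bsub>B3Z\<^esub> g \<otimes>\<^bsub>B3Z\<^esub> u = \<one>\<^bsub>B3Z\<^esub> \<longleftrightarrow> g = u"
  by (simp add: inv_mult_eq_iff)

text \<open>The least time with \<open>P\<close> inherits the condition on \<open>R\<close> from any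
  later one. So first visits may replace arbitrary visits in the definitions of
  \<open>reach_prob\<close> and \<open>qhat\<close>.\<close>

lemma first_visit:
  fixes P R :: "nat \<Rightarrow> bool"
  shows "(\<exists>n\<ge>j. P n \<and> (\<forall>m. j \<le> m \<and> m < n \<longrightarrow> \<not> P m \<and> \<not> R m)) \<longleftrightarrow>
    (\<exists>n\<ge>j. P n \<and> (\<forall>m. j \<le> m \<and> m < n \<longrightarrow> \<not> R m))" (is "?A \<longleftrightarrow> ?B")
proof
  assume ?B
  then obtain n where n: "n \<ge> j" "P n" "\<forall>m. j \<le> m \<and> m < n \<longrightarrow> \<not> R m" by blast
  define k where "k = (LEAST k. k \<ge> j \<and> P k)"
  have "k \<ge> j \<and> P k" unfolding k_def using n LeastI[of "\<lambda>k. k \<ge> j \<and> P k" n] by simp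
  moreover have "k \<le> n" unfolding k_def using n by (intro Least_le) auto
  moreover have "\<not> P m" if "j \<le> m" "m < k" for m
    using not_less_Least[of m "\<lambda>k. k \<ge> j \<and> P k"] that by (auto simp: k_def)
  ultimately show ?A using n by (metis less_le_trans)
qed blast

section \<open>One-step averages and truncated hitting probabilities\<close>

locale step_law =
  fixes \<mu> :: "b3z pmf"
  assumes supp: "set_pmf \<mu> \<subseteq> Sig"
begin

lemma supp_carrier: "set_pmf \<mu> \<subseteq> carrier B3Z"
  using supp Sig_closed by auto

text \<open>Here \<open>x = g^-1 u\<close> is the displacement from the current position
  \<open>g\<close> to a target \<open>u\<close>; an increment \<open>s\<close> turns it into
  \<open>s^-1 x\<close>.\<close>

definition avg :: "(b3z \<Rightarrow> real) \<Rightarrow> b3z \<Rightarrow> real" where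
  "avg h x = (\<Sum>s\<in>Sig. pmf \<mu> s * h (inv\<^bsub>B3Z\<^esub> s \<otimes>\<^bsub>B3Z\<^esub> x))"

lemma sum_pmf: "(\<Sum>s\<in>Sig. pmf \<mu> s) = 1"
  using supp by (intro sum_pmf_eq_1) auto

lemma pmf_conv_pow_Suc:
  assumes "x \<in> carrier B3Z"
  shows "pmf (conv_pow \<mu> (Suc n)) x = avg (pmf (conv_pow \<mu> n)) x"
proof -
  have "pmf (conv_pow \<mu> (Suc n)) x = (\<Sum>s\<in>Sig. pmf (map_pmf (\<lambda>g. s \<otimes>\<^bsub>B3Z\<^esub> g) (conv_pow \<mu> n)) x * pmf \<mu> s)"
    unfolding conv_pow_Suc_left[OF supp_carrier] pmf_bind
    using supp by (intro integral_measure_pmf_real) auto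
  also have "\<dots> = avg (pmf (conv_pow \<mu> n)) x"
    unfolding avg_def using assms conv_pow_closed[OF supp_carrier]
    by (intro sum.cong) (auto simp: pmf_map_left_mult Sig_closed)
  finally show ?thesis .
qed

text \<open>A finite-sum model of the law of \<open>n\<close> independent increments, so that
  recursions for hitting probabilities need no measure theory.\<close>

fun path_prob :: "nat \<Rightarrow> (b3z list \<Rightarrow> bool) \<Rightarrow> real" where
  "path_prob 0 p = of_bool (p [])"
| "path_prob (Suc n) p = (\<Sum>s\<in>Sig. pmf \<mu> s * path_prob n (\<lambda>l. p (s # l)))"

text \<open>With \<open>K\<close> the singleton or the coset of the target, \<open>first_hit K x\<close> describes a path whose
  position \<open>g\<close> and target \<open>u\<close> satisfy \<open>x = g\<^sup>-\<^sup>1 u\<close>: its first visit to \<open>u K\<close> is a visit to \<open>u\<close>.\<close>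

fun first_hit :: "b3z set \<Rightarrow> b3z \<Rightarrow> b3z list \<Rightarrow> bool" where
  "first_hit K x [] = (x = \<one>\<^bsub>B3Z\<^esub>)"
| "first_hit K x (s # l) =
    (if x \<in> K then x = \<one>\<^bsub>B3Z\<^esub> else first_hit K (inv\<^bsub>B3Z\<^esub> s \<otimes>\<^bsub>B3Z\<^esub> x) l)"

text \<open>The first-step recursion for \<open>first_hit\<close> with horizon \<open>n\<close>;
  fixed-point arguments then work on functions of the displacement alone.\<close>

fun hit_prob :: "b3z set \<Rightarrow> nat \<Rightarrow> b3z \<Rightarrow> real" where
  "hit_prob K 0 x = of_bool (x = \<one>\<^bsub>B3Z\<^esub>)"
| "hit_prob K (Suc n) x = (if x \<in> K then of_bool (x = \<one>\<^bsub>B3Z\<^esub>) else avg (hit_prob K n) x)"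

lemma path_prob_const: "path_prob n (\<lambda>_. b) = of_bool b"
  by (induction n) (auto simp: sum_pmf)

lemma path_prob_first_hit: "path_prob n (first_hit K x) = hit_prob K n x"
  by (induction n arbitrary: x) (auto simp: avg_def path_prob_const sum_pmf)

end

section \<open>Joint law of the increments\<close>

locale walk = step_law \<mu> for \<mu> +
  fixes M :: "'w measure" and y Y :: "nat \<Rightarrow> 'w \<Rightarrow> b3z"
  assumes random_walk: "random_walk \<mu> M y Y"
begin

sublocale prob_space M
  using random_walk by (simp add: random_walk_def)

lemma indep: "indep_vars (\<lambda>_. count_space (carrier B3Z)) y {1..}"
  using random_walk by (simp add: random_walk_def)

lemma y_measurable: "1 \<le> n \<Longrightarrow> y n \<in> measurable M (count_space (carrier B3Z))"
  using indep by (auto simp: indep_vars_def2)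

lemma y_closed: "1 \<le> n \<Longrightarrow> \<omega> \<in> space M \<Longrightarrow> y n \<omega> \<in> carrier B3Z"
  using measurable_space[OF y_measurable] by simp

lemma Y_one: "\<omega> \<in> space M \<Longrightarrow> Y 1 \<omega> = \<one>\<^bsub>B3Z\<^esub>"
  using random_walk by (simp add: random_walk_def)

lemma Y_Suc: "1 \<le> n \<Longrightarrow> \<omega> \<in> space M \<Longrightarrow> Y (Suc n) \<omega> = Y n \<omega> \<otimes>\<^bsub>B3Z\<^esub> y n \<omega>"
  using random_walk by (simp add: random_walk_def)

lemma Y_closed: "1 \<le> n \<Longrightarrow> \<omega> \<in> space M \<Longrightarrow> Y n \<omega> \<in> carrier B3Z"
proof (induction n rule: dec_induct)
  case base
  then show ?case using Y_one by simp
next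
  case (step n)
  then show ?case using Y_Suc[of n] y_closed[of n] by simp
qed

definition steps :: "nat \<Rightarrow> nat \<Rightarrow> 'w \<Rightarrow> b3z list" where
  "steps j n \<omega> = map (\<lambda>i. y i \<omega>) [j..<j + n]"

lemma steps_Suc: "steps j (Suc n) \<omega> = y j \<omega> # steps (Suc j) n \<omega>"
  by (simp add: steps_def upt_conv_Cons del: upt_Suc)

lemma steps_Suc_right: "steps j (Suc n) \<omega> = steps j n \<omega> @ [y (j + n) \<omega>]"
  by (simp add: steps_def)

lemma y_event: "1 \<le> i \<Longrightarrow> {\<omega> \<in> space M. y i \<omega> = g} \<in> events"
proof (cases "g \<in> carrier B3Z")
  case True
  assume "1 \<le> i"
  then have "y i -` {g} \<inter> space M \<in> events"
    using y_measurable True by (intro measurable_sets) auto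
  moreover have "y i -` {g} \<inter> space M = {\<omega> \<in> space M. y i \<omega> = g}" by auto
  ultimately show ?thesis by simp
next
  case False
  assume "1 \<le> i"
  then have "{\<omega> \<in> space M. y i \<omega> = g} = {}" using y_closed False by auto
  then show ?thesis by (metis sets.empty_sets)
qed

lemma steps_eq_event: "1 \<le> j \<Longrightarrow> {\<omega> \<in> space M. steps j n \<omega> = l} \<in> events"
proof (induction n arbitrary: j l)
  case 0
  then show ?case by (cases l) (simp_all add: steps_def)
next
  case (Suc n)
  show ?case
  proof (cases l)
    case Nil
    then show ?thesis by (simp add: steps_Suc)
  next
    case (Cons s l')
    have "{\<omega> \<in> space M. steps j (Suc n) \<omega> = l} =
        {\<omega> \<in> space M. y j \<omega> = s} \<inter> {\<omega> \<in> space M. steps (Suc j) n \<omega> = l'}"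
      by (auto simp: steps_Suc Cons)
    then show ?thesis using Suc y_event by simp
  qed
qed

lemma steps_event:
  assumes "1 \<le> j"
  shows "{\<omega> \<in> space M. p (steps j n \<omega>)} \<in> events"
proof -
  have "countable {l \<in> lists (carrier B3Z). p l}"
    using countable_carrier by (intro countable_Collect countable_lists)
  moreover have "{\<omega> \<in> space M. p (steps j n \<omega>)} =
      (\<Union>l\<in>{l \<in> lists (carrier B3Z). p l}. {\<omega> \<in> space M. steps j n \<omega> = l})"
    using assms by (auto simp: steps_def y_closed)
  ultimately show ?thesis
    using steps_eq_event[OF assms] by (metis (no_types, lifting) sets.countable_UN'')
qed

lemma prob_steps_eq:
  assumes "set l \<subseteq> carrier B3Z"
  shows "prob {\<omega> \<in> space M. steps 1 (length l) \<omega> = l} = prod_list (map (pmf \<mu>) l)"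
proof (cases "l = []")
  case True
  then show ?thesis by (simp add: steps_def prob_space)
next
  case False
  define n where "n = length l"
  have "n > 0" using False by (simp add: n_def)
  define A where "A i = y i -` {l ! (i - 1)} \<inter> space M" for i
  have l: "l ! (i - 1) \<in> carrier B3Z" if "i \<in> {1..n}" for i
    using that assms nth_mem[of "i - 1" l] by (auto simp: n_def subset_iff)
  have "{\<omega> \<in> space M. steps 1 (length l) \<omega> = l} = (\<Inter>i\<in>{1..n}. A i)"
  proof -
    have "steps 1 (length l) \<omega> = l \<longleftrightarrow> (\<forall>i\<in>{1..n}. y i \<omega> = l ! (i - 1))" for \<omega>
    proof -
      have "steps 1 (length l) \<omega> = l \<longleftrightarrow> (\<forall>i<n. y (Suc i) \<omega> = l ! i)"
        unfolding list_eq_iff_nth_eq steps_def by (simp add: n_def del: upt_Suc)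
      also have "\<dots> \<longleftrightarrow> (\<forall>i\<in>Suc ` {..<n}. y i \<omega> = l ! (i - 1))" by auto
      also have "Suc ` {..<n} = {1..n}" by (simp add: image_Suc_lessThan)
      finally show ?thesis .
    qed
    then show ?thesis using \<open>n > 0\<close> by (auto simp: A_def)
  qed
  also have "prob \<dots> = (\<Prod>i\<in>{1..n}. prob (A i))"
  proof (rule indep_setsD[where I = "{1..}"])
    show "indep_sets (\<lambda>i. {y i -` A \<inter> space M |A. A \<in> sets (count_space (carrier B3Z))}) {1..}"
      using indep unfolding indep_vars_def2 by simp
    show "\<forall>i\<in>{1..n}. A i \<in> {y i -` A \<inter> space M |A. A \<in> sets (count_space (carrier B3Z))}"
      using l by (auto simp: A_def)
  qed (use \<open>n > 0\<close> in auto)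
  also have "\<dots> = (\<Prod>i\<in>{1..n}. pmf \<mu> (l ! (i - 1)))"
  proof (rule prod.cong)
    fix i assume i: "i \<in> {1..n}"
    have "A i = {\<omega> \<in> space M. y i \<omega> = l ! (i - 1)}" by (auto simp: A_def)
    then show "prob (A i) = pmf \<mu> (l ! (i - 1))"
      using random_walk l[OF i] i by (simp add: random_walk_def)
  qed simp
  also have "\<dots> = (\<Prod>i<n. pmf \<mu> (l ! i))"
    by (rule prod.reindex_bij_witness[of _ Suc "\<lambda>i. i - 1"]) auto
  also have "\<dots> = prod_list (map (pmf \<mu>) l)"
    by (simp add: prod.list_conv_set_nth n_def lessThan_atLeast0)
  finally show ?thesis .
qed

lemma AE_y_Sig:
  assumes "1 \<le> i"
  shows "AE \<omega> in M. y i \<omega> \<in> Sig"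
proof -
  have "prob {\<omega> \<in> space M. y i \<omega> \<in> Sig} = prob (\<Union>s\<in>Sig. {\<omega> \<in> space M. y i \<omega> = s})"
    by (rule arg_cong[of _ _ prob]) auto
  also have "\<dots> = (\<Sum>s\<in>Sig. prob {\<omega> \<in> space M. y i \<omega> = s})"
    using assms y_event by (intro finite_measure_finite_Union) (auto simp: disjoint_family_on_def)
  also have "\<dots> = (\<Sum>s\<in>Sig. pmf \<mu> s)"
    using random_walk assms Sig_closed by (intro sum.cong) (auto simp: random_walk_def)
  finally have "prob {\<omega> \<in> space M. y i \<omega> \<in> Sig} = 1" by (simp add: sum_pmf)
  then show ?thesis by (rule AE_prob_1[THEN AE_mp]) auto
qed

text \<open>Independence yields the probability of a complete increment word. The induction
  therefore moves one increment at a time from the tail, constrained by \<open>p\<close>, into the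
  fixed prefix \<open>l\<close>, until the tail is empty.\<close>

lemma prob_prefix:
  assumes "set l \<subseteq> Sig"
  shows "prob {\<omega> \<in> space M. steps 1 (length l) \<omega> = l \<and> p (steps (Suc (length l)) n \<omega>)} =
    prod_list (map (pmf \<mu>) l) * path_prob n p"
  using assms
proof (induction n arbitrary: l p)
  case 0
  have "set l \<subseteq> carrier B3Z" using 0 Sig_closed by auto
  then show ?case
    using prob_steps_eq[of l] by (cases "p []") (simp_all add: steps_def)
next
  case (Suc n)
  let ?k = "Suc (length l)"
  let ?E = "{\<omega> \<in> space M. steps 1 (length l) \<omega> = l \<and> p (steps ?k (Suc n) \<omega>)}"
  let ?E' = "\<lambda>s. {\<omega> \<in> space M. steps 1 (length (l @ [s])) \<omega> = l @ [s] \<and>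
    p (s # steps (Suc (length (l @ [s]))) n \<omega>)}"
  have E': "?E' s = {\<omega> \<in> space M. steps 1 (length l) \<omega> = l \<and> y ?k \<omega> = s \<and> p (steps ?k (Suc n) \<omega>)}" for s
    using steps_Suc[of ?k n] steps_Suc_right[of 1 "length l"] by auto
  have ev: "{\<omega> \<in> space M. q (steps 1 (length l) \<omega>) \<and> q' (steps ?k (Suc n) \<omega>)} \<in> events" for q q'
  proof -
    have "{\<omega> \<in> space M. q (steps 1 (length l) \<omega>)} \<inter> {\<omega> \<in> space M. q' (steps ?k (Suc n) \<omega>)} \<in> events"
      by (intro sets.Int steps_event) auto
    moreover have "{\<omega> \<in> space M. q (steps 1 (length l) \<omega>)} \<inter> {\<omega> \<in> space M. q' (steps ?k (Suc n) \<omega>)} =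
        {\<omega> \<in> space M. q (steps 1 (length l) \<omega>) \<and> q' (steps ?k (Suc n) \<omega>)}" by auto
    ultimately show ?thesis by simp
  qed
  have ev': "?E' s \<in> events" for s
  proof -
    have "?E' s = {\<omega> \<in> space M. steps 1 (length l) \<omega> = l \<and> (\<lambda>m. hd m = s \<and> p m) (steps ?k (Suc n) \<omega>)}"
      unfolding E' by (simp add: steps_Suc)
    then show ?thesis using ev[of "\<lambda>m. m = l" "\<lambda>m. hd m = s \<and> p m"] by simp
  qed
  \<comment> \<open>Splitting by the next increment loses only the null event that it falls outside
    \<open>Sig\<close>.\<close>
  have "prob ?E = prob (\<Union>s\<in>Sig. ?E' s)"
  proof (rule finite_measure_eq_AE)
    show "AE \<omega> in M. \<omega> \<in> ?E \<longleftrightarrow> \<omega> \<in> (\<Union>s\<in>Sig. ?E' s)"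
      using AE_y_Sig[of ?k] unfolding E' by (auto elim!: AE_mp)
    show "?E \<in> events" by (rule ev)
    show "(\<Union>s\<in>Sig. ?E' s) \<in> events" using ev' by auto
  qed
  also have "\<dots> = (\<Sum>s\<in>Sig. prob (?E' s))"
    using ev' by (intro finite_measure_finite_Union) (auto simp: disjoint_family_on_def)
  also have "\<dots> = (\<Sum>s\<in>Sig. prod_list (map (pmf \<mu>) (l @ [s])) * path_prob n (\<lambda>m. p (s # m)))"
    using Suc.prems by (intro sum.cong HOL.refl Suc.IH) auto
  finally show ?case by (simp add: sum_distrib_left mult_ac)
qed

lemma prob_steps: "prob {\<omega> \<in> space M. p (steps 1 n \<omega>)} = path_prob n p"
  using prob_prefix[of "[]" p n] by (simp add: steps_def)

section \<open>First visits as path events\<close>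

lemma first_hit_steps:
  assumes "1 \<le> j" "\<omega> \<in> space M" "u \<in> carrier B3Z" "\<one>\<^bsub>B3Z\<^esub> \<in> K"
  shows "first_hit K (inv\<^bsub>B3Z\<^esub> Y j \<omega> \<otimes>\<^bsub>B3Z\<^esub> u) (steps j n \<omega>) \<longleftrightarrow>
    (\<exists>m. j \<le> m \<and> m \<le> j + n \<and> Y m \<omega> = u \<and> (\<forall>i. j \<le> i \<and> i < m \<longrightarrow> inv\<^bsub>B3Z\<^esub> Y i \<omega> \<otimes>\<^bsub>B3Z\<^esub> u \<notin> K))"
  using assms(1)
proof (induction n arbitrary: j)
  have one: "inv\<^bsub>B3Z\<^esub> Y j \<omega> \<otimes>\<^bsub>B3Z\<^esub> u = \<one>\<^bsub>B3Z\<^esub> \<longleftrightarrow> Y j \<omega> = u" if "1 \<le> j" for j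
    using inv_mult_eq_one[OF Y_closed[OF that assms(2)] assms(3)] .
  {
    case 0
    then show ?case by (auto simp: steps_def one intro!: exI[of _ j] dest: le_antisym)
  next
    case (Suc n)
    let ?x = "inv\<^bsub>B3Z\<^esub> Y j \<omega> \<otimes>\<^bsub>B3Z\<^esub> u"
    show ?case
    proof (cases "?x \<in> K")
      case True
      then have "m = j" if "j \<le> m" "\<forall>i. j \<le> i \<and> i < m \<longrightarrow> inv\<^bsub>B3Z\<^esub> Y i \<omega> \<otimes>\<^bsub>B3Z\<^esub> u \<notin> K" for m
        using that by (metis le_neq_implies_less le_refl)
      then have "(\<exists>m. j \<le> m \<and> m \<le> j + Suc n \<and> Y m \<omega> = u \<and> (\<forall>i. j \<le> i \<and> i < m \<longrightarrow> inv\<^bsub>B3Z\<^esub> Y i \<omega> \<otimes>\<^bsub>B3Z\<^esub> u \<notin> K))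
          \<longleftrightarrow> Y j \<omega> = u"
        by (metis le_add1 le_refl not_less)
      then show ?thesis using True one[OF Suc.prems] by (simp add: steps_Suc)
    next
      case False
      \<comment> \<open>The displacement at time \<open>j + 1\<close> is the one that the recursion
        of \<open>first_hit\<close> passes on.\<close>
      have "inv\<^bsub>B3Z\<^esub> y j \<omega> \<otimes>\<^bsub>B3Z\<^esub> ?x = inv\<^bsub>B3Z\<^esub> Y (Suc j) \<omega> \<otimes>\<^bsub>B3Z\<^esub> u"
        using Suc.prems assms(2,3) Y_closed[of j \<omega>] y_closed[of j \<omega>]
        by (simp add: Y_Suc Z.inv_mult_group Z.m_assoc)
      then have "first_hit K ?x (steps j (Suc n) \<omega>) \<longleftrightarrow>
          first_hit K (inv\<^bsub>B3Z\<^esub> Y (Suc j) \<omega> \<otimes>\<^bsub>B3Z\<^esub> u) (steps (Suc j) n \<omega>)"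
        using False by (simp add: steps_Suc)
      also have "\<dots> \<longleftrightarrow> (\<exists>m. Suc j \<le> m \<and> m \<le> j + Suc n \<and> Y m \<omega> = u \<and>
          (\<forall>i. Suc j \<le> i \<and> i < m \<longrightarrow> inv\<^bsub>B3Z\<^esub> Y i \<omega> \<otimes>\<^bsub>B3Z\<^esub> u \<notin> K))"
        using Suc.prems by (subst Suc.IH) auto
      also have "\<dots> \<longleftrightarrow> (\<exists>m. j \<le> m \<and> m \<le> j + Suc n \<and> Y m \<omega> = u \<and>
          (\<forall>i. j \<le> i \<and> i < m \<longrightarrow> inv\<^bsub>B3Z\<^esub> Y i \<omega> \<otimes>\<^bsub>B3Z\<^esub> u \<notin> K))"
      proof -
        \<comment> \<open>Since \<open>1\<close> lies in \<open>K\<close>, a displacement outside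
          \<open>K\<close> at time \<open>j\<close> rules out a visit to \<open>u\<close> there, so
          the range of \<open>m\<close> may start at \<open>j\<close>.\<close>
        have "Y j \<omega> \<noteq> u" using False one[OF Suc.prems] assms(4) by auto
        then have "(Suc j \<le> m \<and> m \<le> j + Suc n \<and> Y m \<omega> = u \<and>
            (\<forall>i. Suc j \<le> i \<and> i < m \<longrightarrow> inv\<^bsub>B3Z\<^esub> Y i \<omega> \<otimes>\<^bsub>B3Z\<^esub> u \<notin> K)) \<longleftrightarrow>
          (j \<le> m \<and> m \<le> j + Suc n \<and> Y m \<omega> = u \<and>
            (\<forall>i. j \<le> i \<and> i < m \<longrightarrow> inv\<^bsub>B3Z\<^esub> Y i \<omega> \<otimes>\<^bsub>B3Z\<^esub> u \<notin> K))" for m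
          using False by (metis Suc_leD Suc_leI le_neq_implies_less)
        then show ?thesis by (rule ex_cong1)
      qed
      finally show ?thesis .
    qed
  }
qed

text \<open>Continuity from below: \<open>n\<close> increments decide whether \<open>u\<close> is
  visited by time \<open>n + 1\<close>, as the walk starts at time 1.\<close>

lemma reach_prob_lim:
  assumes "u \<in> carrier B3Z"
  shows "(\<lambda>n. hit_prob {\<one>\<^bsub>B3Z\<^esub>} n u) \<longlonglongrightarrow> reach_prob M Y u"
proof -
  let ?K = "{\<one>\<^bsub>B3Z\<^esub>}"
  define A where "A n = {\<omega> \<in> space M. first_hit ?K u (steps 1 n \<omega>)}" for n
  have one: "inv\<^bsub>B3Z\<^esub> Y j \<omega> \<otimes>\<^bsub>B3Z\<^esub> u = \<one>\<^bsub>B3Z\<^esub> \<longleftrightarrow> Y j \<omega> = u" if "1 \<le> j" "\<omega> \<in> space M" for j \<omega>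
    using inv_mult_eq_one[OF Y_closed[OF that] assms] .
  have A: "A n = {\<omega> \<in> space M. \<exists>m. 1 \<le> m \<and> m \<le> 1 + n \<and> Y m \<omega> = u \<and> (\<forall>i. 1 \<le> i \<and> i < m \<longrightarrow> Y i \<omega> \<noteq> u)}" for n
    unfolding A_def
  proof (rule Collect_cong, rule conj_cong[OF HOL.refl])
    fix \<omega> assume \<omega>: "\<omega> \<in> space M"
    show "first_hit ?K u (steps 1 n \<omega>) \<longleftrightarrow>
      (\<exists>m. 1 \<le> m \<and> m \<le> 1 + n \<and> Y m \<omega> = u \<and> (\<forall>i. 1 \<le> i \<and> i < m \<longrightarrow> Y i \<omega> \<noteq> u))"
      using first_hit_steps[of 1 \<omega> u ?K n] \<omega> assms Y_one[OF \<omega>] one[OF _ \<omega>] by (simp cong: conj_cong)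
  qed
  have "(\<lambda>n. prob (A n)) \<longlonglongrightarrow> prob (\<Union>n. A n)"
  proof (rule finite_Lim_measure_incseq)
    show "range A \<subseteq> events" using steps_event[of 1] by (auto simp: A_def)
    show "incseq A"
      by (rule incseq_SucI, unfold A, rule Collect_mono) (metis add_Suc_right le_SucI)
  qed
  moreover have "prob (A n) = hit_prob ?K n u" for n
    unfolding A_def prob_steps path_prob_first_hit ..
  moreover have "(\<Union>n. A n) = {\<omega> \<in> space M. \<exists>n\<ge>1. Y n \<omega> = u}"
  proof -
    have "(\<Union>n. A n) = {\<omega> \<in> space M. \<exists>m\<ge>1. Y m \<omega> = u \<and> (\<forall>i. 1 \<le> i \<and> i < m \<longrightarrow> \<not> Y i \<omega> = u \<and> \<not> False)}"
      unfolding A by auto (metis le_SucI order_refl)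
    then show ?thesis unfolding first_visit by simp
  qed
  ultimately show ?thesis by (simp add: reach_prob_def)
qed

text \<open>\<open>qhat\<close> ignores time 1, so the first increment is unconditional and supplies
  the outer \<open>avg\<close>; visits to \<open>{u, u \<Delta>}\<close> are watched from time 2
  on.\<close>

lemma qhat_lim:
  assumes u: "u \<in> carrier B3Z"
  shows "(\<lambda>n. avg (hit_prob {\<one>\<^bsub>B3Z\<^esub>, \<Delta>} n) u) \<longlonglongrightarrow> qhat M Y u"
proof -
  let ?K = "{\<one>\<^bsub>B3Z\<^esub>, \<Delta>}"
  define p where "p l = first_hit ?K (inv\<^bsub>B3Z\<^esub> hd l \<otimes>\<^bsub>B3Z\<^esub> u) (tl l)" for l
  define A where "A n = {\<omega> \<in> space M. p (steps 1 (Suc n) \<omega>)}" for n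
  have K: "inv\<^bsub>B3Z\<^esub> Y j \<omega> \<otimes>\<^bsub>B3Z\<^esub> u \<in> ?K \<longleftrightarrow> Y j \<omega> = u \<or> Y j \<omega> = u \<otimes>\<^bsub>B3Z\<^esub> \<Delta>"
    if "1 \<le> j" "\<omega> \<in> space M" for j \<omega>
  proof -
    have eq: "inv\<^bsub>B3Z\<^esub> Y j \<omega> \<otimes>\<^bsub>B3Z\<^esub> u = k \<longleftrightarrow> Y j \<omega> = u \<otimes>\<^bsub>B3Z\<^esub> inv\<^bsub>B3Z\<^esub> k" if "k \<in> carrier B3Z" for k
      using inv_mult_eq_iff[OF Y_closed[OF \<open>1 \<le> j\<close> \<open>\<omega> \<in> space M\<close>] u that] .
    show ?thesis using eq[of "\<one>\<^bsub>B3Z\<^esub>"] eq[of \<Delta>] u by simp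
  qed
  have A: "A n = {\<omega> \<in> space M. \<exists>m. 2 \<le> m \<and> m \<le> 2 + n \<and> Y m \<omega> = u \<and>
      (\<forall>i. 2 \<le> i \<and> i < m \<longrightarrow> \<not> Y i \<omega> = u \<and> \<not> Y i \<omega> = u \<otimes>\<^bsub>B3Z\<^esub> \<Delta>)}" for n
    unfolding A_def
  proof (rule Collect_cong, rule conj_cong[OF HOL.refl])
    fix \<omega> assume \<omega>: "\<omega> \<in> space M"
    have "Y 2 \<omega> = y 1 \<omega>"
      using Y_Suc[of 1 \<omega>] Y_one[OF \<omega>] y_closed[of 1 \<omega>] \<omega> by (simp add: numeral_2_eq_2)
    then have "p (steps 1 (Suc n) \<omega>) \<longleftrightarrow> first_hit ?K (inv\<^bsub>B3Z\<^esub> Y 2 \<omega> \<otimes>\<^bsub>B3Z\<^esub> u) (steps 2 n \<omega>)"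
      by (simp add: p_def steps_Suc numeral_2_eq_2)
    also have "\<dots> \<longleftrightarrow> (\<exists>m. 2 \<le> m \<and> m \<le> 2 + n \<and> Y m \<omega> = u \<and>
        (\<forall>i. 2 \<le> i \<and> i < m \<longrightarrow> inv\<^bsub>B3Z\<^esub> Y i \<omega> \<otimes>\<^bsub>B3Z\<^esub> u \<notin> ?K))"
      using \<omega> u by (intro first_hit_steps) auto
    also have "\<dots> \<longleftrightarrow> (\<exists>m. 2 \<le> m \<and> m \<le> 2 + n \<and> Y m \<omega> = u \<and>
        (\<forall>i. 2 \<le> i \<and> i < m \<longrightarrow> \<not> Y i \<omega> = u \<and> \<not> Y i \<omega> = u \<otimes>\<^bsub>B3Z\<^esub> \<Delta>))"
    proof -
      have "2 \<le> i \<Longrightarrow> inv\<^bsub>B3Z\<^esub> Y i \<omega> \<otimes>\<^bsub>B3Z\<^esub> u \<notin> ?K \<longleftrightarrow> \<not> Y i \<omega> = u \<and> \<not> Y i \<omega> = u \<otimes>\<^bsub>B3Z\<^esub> \<Delta>" for i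
        using K[of i \<omega>] \<omega> by simp
      then show ?thesis by (simp cong: conj_cong imp_cong)
    qed
    finally show "p (steps 1 (Suc n) \<omega>) \<longleftrightarrow> \<dots>" .
  qed
  have "(\<lambda>n. prob (A n)) \<longlonglongrightarrow> prob (\<Union>n. A n)"
  proof (rule finite_Lim_measure_incseq)
    show "range A \<subseteq> events" using steps_event[of 1] by (auto simp: A_def)
    show "incseq A"
      by (rule incseq_SucI, unfold A, rule Collect_mono) (metis add_Suc_right le_SucI)
  qed
  moreover have "prob (A n) = avg (hit_prob ?K n) u" for n
    unfolding A_def prob_steps by (simp add: p_def path_prob_first_hit avg_def)
  moreover have "(\<Union>n. A n) = {\<omega> \<in> space M. \<exists>n>1. Y n \<omega> = u \<and> (\<forall>m. 1 < m \<and> m < n \<longrightarrow> Y m \<omega> \<noteq> u \<otimes>\<^bsub>B3Z\<^esub> \<Delta>)}"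
  proof -
    have "(\<Union>n. A n) = {\<omega> \<in> space M. \<exists>m\<ge>2. Y m \<omega> = u \<and>
        (\<forall>i. 2 \<le> i \<and> i < m \<longrightarrow> \<not> Y i \<omega> = u \<and> \<not> Y i \<omega> = u \<otimes>\<^bsub>B3Z\<^esub> \<Delta>)}"
      unfolding A by auto (metis le_SucI order_refl)
    then show ?thesis unfolding first_visit by (simp add: numeral_2_eq_2 Suc_le_eq)
  qed
  ultimately show ?thesis by (simp add: qhat_def)
qed

end

section \<open>Garside paths\<close>

text \<open>Once the leading exponent and the signs are fixed, the trailing exponents remain to be
  chosen, each forcing the next leading one. The empty word has product \<open>1\<close>, whose code
  is \<open>mk e [] f\<close> exactly for \<open>e = f\<close>.\<close>

fun paths :: "bool \<Rightarrow> bool list \<Rightarrow> bool \<Rightarrow> b3z list set" where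
  "paths e [] f = (if e = f then {[]} else {})"
| "paths e (s # ss) f = (\<Union>g. (#) (elt e s g) ` paths (\<not> g) ss f)"

lemma gprod_simps [simp]: "gprod [] = \<one>\<^bsub>B3Z\<^esub>" "gprod (u # us) = u \<otimes>\<^bsub>B3Z\<^esub> gprod us"
  by (simp_all add: gprod_def)

lemma gprod_closed: "set us \<subseteq> carrier B3Z \<Longrightarrow> gprod us \<in> carrier B3Z"
  by (induction us) auto

lemma finite_paths [simp]: "finite (paths e ss f)"
  by (induction ss arbitrary: e) auto

lemma length_paths: "us \<in> paths e ss f \<Longrightarrow> length us = length ss"
  by (induction ss arbitrary: e us) (auto split: if_splits)

lemma set_paths: "us \<in> paths e ss f \<Longrightarrow> set us \<subseteq> Sig"
  by (induction ss arbitrary: e us) (auto split: if_splits, blast)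

lemma hd_paths: "us \<in> paths e (s # ss) f \<Longrightarrow> \<exists>g. hd us = elt e s g"
  by auto

lemma code_gprod_paths: "us \<in> paths e ss f \<Longrightarrow> code (gprod us) = mk e ss f"
proof (induction ss arbitrary: e us)
  case Nil
  then show ?case by (auto split: if_splits)
next
  case (Cons s ss)
  then obtain g vs where us: "us = elt e s g # vs" and vs: "vs \<in> paths (\<not> g) ss f" by auto
  have "set vs \<subseteq> carrier B3Z" using set_paths[OF vs] Sig_closed by blast
  then show ?case
    using elt_mult_mk(1)[OF gprod_closed Cons.IH[OF vs], where g = g and d = e and s = s] us by simp
qed

lemma successively_paths: "us \<in> paths e ss f \<Longrightarrow> successively (\<lambda>u v. v \<in> Next u) us"
proof (induction ss arbitrary: e us)
  case Nil
  then show ?case by (auto split: if_splits)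
next
  case (Cons s ss)
  then obtain g vs where us: "us = elt e s g # vs" and vs: "vs \<in> paths (\<not> g) ss f" by auto
  have "hd vs \<in> Next (elt e s g)" if ne: "vs \<noteq> []"
  proof -
    obtain t ts where "ss = t # ts" using ne vs by (cases ss) (auto split: if_splits)
    then show ?thesis using hd_paths[of vs "\<not> g" t ts f] vs by auto
  qed
  then show ?case using us Cons.IH[OF vs] by (auto simp: successively_Cons)
qed

lemma paths_exhaust:
  assumes "set us \<subseteq> Sig" "successively (\<lambda>u v. v \<in> Next u) us"
  shows "\<exists>e ss f. us \<in> paths e ss f"
  using assms
proof (induction us)
  case Nil
  show ?case by (intro exI[of _ True] exI[of _ "[]"]) simp
next
  case (Cons u us)
  obtain e s g where u: "u = elt e s g" using Cons.prems by (auto elim: SigE)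
  have "\<exists>ss f. us \<in> paths (\<not> g) ss f"
  proof (cases "us = []")
    case True
    \<comment> \<open>With nothing after \<open>u\<close>, the final exponent is set to
      \<open>\<not> g\<close> so that the empty tail is admissible.\<close>
    then show ?thesis by (intro exI[of _ "[]"] exI[of _ "\<not> g"]) simp
  next
    case False
    obtain e' ss f where us: "us \<in> paths e' ss f"
      using Cons by (auto simp: successively_Cons)
    then obtain t ts where "ss = t # ts" using False by (cases ss) (auto split: if_splits)
    moreover have "hd us \<in> Next u" using Cons.prems False by (auto simp: successively_Cons)
    ultimately have "e' = (\<not> g)" using hd_paths[of us e' t ts f] us u by auto
    then show ?thesis using us by blast
  qed
  then obtain ss f where "us \<in> paths (\<not> g) ss f" by blast
  then have "u # us \<in> paths e (s # ss) f" using u by auto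
  then show ?case by blast
qed

text \<open>Taking \<open>g = (e = s)\<close> at every letter stays in \<open>T\<close>; the final
  exponent \<open>f\<close> is then forced, which is why normal forms carry a separate power of
  \<open>\<Delta>\<close>.\<close>

lemma Tset_path: "\<exists>us f. us \<in> paths e ss f \<and> set us \<subseteq> Tset"
proof (induction ss arbitrary: e)
  case Nil
  show ?case by (intro exI[of _ "[]"] exI[of _ e]) simp
next
  case (Cons s ss)
  obtain us f where "us \<in> paths (\<not> (e = s)) ss f" "set us \<subseteq> Tset" using Cons by blast
  then have "elt e s (e = s) # us \<in> paths e (s # ss) f" "set (elt e s (e = s) # us) \<subseteq> Tset"
    unfolding paths.simps by (blast, simp)
  then show ?case by blast
qed

section \<open>Garside length and the sets \<open>psi_inv\<close>\<close>

lemma successively_Next_iff: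
  assumes "set us \<subseteq> Sig"
  shows "successively (\<lambda>u v. v \<in> Next u) us \<longleftrightarrow>
    (\<forall>i. Suc i < length us \<longrightarrow> Last (us ! i) = First (us ! Suc i))"
proof -
  have "us ! Suc i \<in> Next (us ! i) \<longleftrightarrow> Last (us ! i) = First (us ! Suc i)" if "Suc i < length us" for i
    using assms nth_mem[OF that] by (auto simp: Next_def)
  then show ?thesis by (auto simp: successively_conv_nth)
qed

lemma Tset_Sig: "Tset \<subseteq> Sig"
  by (simp add: Sig_def)

text \<open>The final power of \<open>\<Delta>\<close> changes only \<open>f\<close>, so the code of
  \<open>v\<close> fixes the sign list of every normal form and hence its length.\<close>

lemma garside_nf_mk:
  assumes v: "v \<in> carrier B3Z" "code v = mk e (s # ss) f"
  shows "(\<exists>ts \<epsilon>. garside_nf v ts \<epsilon> \<and> length ts = k) \<longleftrightarrow> k = Suc (length ss)"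
proof
  assume "\<exists>ts \<epsilon>. garside_nf v ts \<epsilon> \<and> length ts = k"
  then obtain ts \<epsilon> where *: "garside_nf v ts \<epsilon>" and k: "length ts = k" by blast
  have ts: "set ts \<subseteq> Sig" using * Tset_Sig by (auto simp: garside_nf_def)
  then have "successively (\<lambda>u v. v \<in> Next u) ts"
    using * by (simp add: successively_Next_iff garside_nf_def)
  with ts obtain e' ss' f' where p: "ts \<in> paths e' ss' f'" using paths_exhaust by blast
  have closed: "gprod ts \<in> carrier B3Z" using ts Sig_closed by (intro gprod_closed) auto
  have "\<epsilon> = 0 \<or> \<epsilon> = 1" "v = gprod ts \<otimes>\<^bsub>B3Z\<^esub> \<Delta> [^]\<^bsub>B3Z\<^esub> \<epsilon>" using * by (auto simp: garside_nf_def)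
  then have "code v = mk e' ss' f' \<or> code v = mk e' ss' (\<not> f')"
    using code_gprod_paths[OF p] closed by auto
  then have "ss' = s # ss" using v(2) mk_eq_iff[of e "s # ss" f e' ss'] by (auto simp del: mk.simps)
  then show "k = Suc (length ss)" using length_paths[OF p] k by simp
next
  assume k: "k = Suc (length ss)"
  obtain ts f' where p: "ts \<in> paths e (s # ss) f'" and T: "set ts \<subseteq> Tset" using Tset_path by blast
  have ts: "set ts \<subseteq> Sig" using T Tset_Sig by blast
  then have closed: "gprod ts \<in> carrier B3Z" using Sig_closed by (intro gprod_closed) auto
  \<comment> \<open>Corrects the final exponent if the path inside \<open>T\<close> ends with the
    wrong parity.\<close>
  define \<epsilon> :: nat where "\<epsilon> = (if f = f' then 0 else 1)"
  have "v = gprod ts \<otimes>\<^bsub>B3Z\<^esub> \<Delta> [^]\<^bsub>B3Z\<^esub> \<epsilon>"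
    using v closed code_gprod_paths[OF p] by (intro code_eqI) (auto simp: \<epsilon>_def)
  then have "garside_nf v ts \<epsilon>"
    using T successively_paths[OF p] ts by (auto simp: garside_nf_def successively_Next_iff \<epsilon>_def)
  moreover have "length ts = k" using length_paths[OF p] k by simp
  ultimately show "\<exists>ts \<epsilon>. garside_nf v ts \<epsilon> \<and> length ts = k" by blast
qed

text \<open>For a nonempty sign list, \<open>e\<close>, the signs and \<open>f\<close> can be
  recovered from the code, so every admissible word with product \<open>v\<close> is a path for
  these data.\<close>

lemma psi_inv_mk:
  assumes v: "v \<in> carrier B3Z" "code v = mk e (s # ss) f"
  shows "psi_inv v = paths e (s # ss) f"
proof -
  have len: "lenT v = Suc (length ss)"
    unfolding lenT_def garside_nf_mk[OF v] by simp
  have "us \<in> psi_inv v \<longleftrightarrow> us \<in> paths e (s # ss) f" for us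
  proof
    assume *: "us \<in> psi_inv v"
    then have "set us \<subseteq> Sig" "successively (\<lambda>u v. v \<in> Next u) us"
      by (auto simp: psi_inv_def successively_conv_nth)
    then obtain e' ss' f' where p: "us \<in> paths e' ss' f'" using paths_exhaust by blast
    have "mk e' ss' f' = mk e (s # ss) f"
      using code_gprod_paths[OF p] * v(2) by (simp add: psi_inv_def)
    then have "e' = e" "ss' = s # ss" "f' = f" unfolding mk_eq_iff by (auto split: if_splits)
    then show "us \<in> paths e (s # ss) f" using p by simp
  next
    assume p: "us \<in> paths e (s # ss) f"
    have "gprod us \<in> carrier B3Z" using set_paths[OF p] Sig_closed by (intro gprod_closed) auto
    then have "gprod us = v" using v code_gprod_paths[OF p] by (intro code_eqI) auto
    then show "us \<in> psi_inv v"
      using length_paths[OF p] set_paths[OF p] successively_paths[OF p] len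
      by (auto simp: psi_inv_def successively_conv_nth)
  qed
  then show ?thesis by blast
qed

section \<open>Decaying harmonic functions\<close>

text \<open>The positive part vanishes at infinity. Being one-sided, the notion passes to smaller
  functions, such as \<open>H - L\<close> with \<open>L \<ge> 0\<close>.\<close>

definition decays :: "(b3z \<Rightarrow> real) \<Rightarrow> bool" where
  "decays h \<longleftrightarrow> (\<forall>\<epsilon>>0. finite {x \<in> carrier B3Z. \<epsilon> \<le> h x})"

lemma decays_mono:
  assumes "decays h" "\<And>x. x \<in> carrier B3Z \<Longrightarrow> h' x \<le> h x"
  shows "decays h'"
  unfolding decays_def
proof (intro allI impI)
  fix \<epsilon> :: real assume "\<epsilon> > 0"
  then have "finite {x \<in> carrier B3Z. \<epsilon> \<le> h x}" using assms(1) by (simp add: decays_def)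
  then show "finite {x \<in> carrier B3Z. \<epsilon> \<le> h' x}"
    by (rule rev_finite_subset) (use assms(2) order_trans in blast)
qed

lemma decays_add:
  assumes "decays h" "decays h'"
  shows "decays (\<lambda>x. h x + h' x)"
  unfolding decays_def
proof (intro allI impI)
  fix \<epsilon> :: real assume "\<epsilon> > 0"
  then have "finite ({x \<in> carrier B3Z. \<epsilon> / 2 \<le> h x} \<union> {x \<in> carrier B3Z. \<epsilon> / 2 \<le> h' x})"
    using assms half_gt_zero[OF \<open>\<epsilon> > 0\<close>] unfolding decays_def by blast
  then show "finite {x \<in> carrier B3Z. \<epsilon> \<le> h x + h' x}"
    by (rule rev_finite_subset) auto
qed

lemma decays_cmult:
  assumes "decays h" "c > 0"
  shows "decays (\<lambda>x. c * h x)"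
  unfolding decays_def
proof (intro allI impI)
  fix \<epsilon> :: real assume "\<epsilon> > 0"
  then have "finite {x \<in> carrier B3Z. \<epsilon> / c \<le> h x}"
    using assms by (simp add: decays_def)
  moreover have "\<epsilon> \<le> c * h x \<longleftrightarrow> \<epsilon> / c \<le> h x" for x
    using assms(2) by (simp add: field_simps)
  ultimately show "finite {x \<in> carrier B3Z. \<epsilon> \<le> c * h x}" by simp
qed

lemma decays_translate:
  assumes "decays h" "g \<in> carrier B3Z"
  shows "decays (\<lambda>x. h (x \<otimes>\<^bsub>B3Z\<^esub> g))"
  unfolding decays_def
proof (intro allI impI)
  fix \<epsilon> :: real assume "\<epsilon> > 0"
  then have "finite {x \<in> carrier B3Z. \<epsilon> \<le> h x}" using assms by (simp add: decays_def)
  then have "finite ((\<lambda>x. x \<otimes>\<^bsub>B3Z\<^esub> inv\<^bsub>B3Z\<^esub> g) ` {x \<in> carrier B3Z. \<epsilon> \<le> h x})" by simp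
  then show "finite {x \<in> carrier B3Z. \<epsilon> \<le> h (x \<otimes>\<^bsub>B3Z\<^esub> g)}"
  proof (rule rev_finite_subset, intro subsetI)
    fix x assume "x \<in> {x \<in> carrier B3Z. \<epsilon> \<le> h (x \<otimes>\<^bsub>B3Z\<^esub> g)}"
    then show "x \<in> (\<lambda>x. x \<otimes>\<^bsub>B3Z\<^esub> inv\<^bsub>B3Z\<^esub> g) ` {x \<in> carrier B3Z. \<epsilon> \<le> h x}"
      using assms(2) by (intro image_eqI[of _ _ "x \<otimes>\<^bsub>B3Z\<^esub> g"]) (auto simp: Z.m_assoc)
  qed
qed

section \<open>Algebra of the averaging operator\<close>

context step_law
begin

lemma avg_mono:
  assumes "x \<in> carrier B3Z" "\<And>z. z \<in> carrier B3Z \<Longrightarrow> h z \<le> h' z"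
  shows "avg h x \<le> avg h' x"
  unfolding avg_def using assms by (intro sum_mono mult_left_mono) (auto simp: Sig_closed)

lemma avg_add: "avg (\<lambda>z. h z + h' z) x = avg h x + avg h' x"
  by (simp add: avg_def distrib_left sum.distrib)

lemma avg_diff: "avg (\<lambda>z. h z - h' z) x = avg h x - avg h' x"
  by (simp add: avg_def right_diff_distrib sum_subtractf)

lemma avg_cmult: "avg (\<lambda>z. c * h z) x = c * avg h x"
  by (simp add: avg_def sum_distrib_left mult_ac)

lemma avg_sum: "avg (\<lambda>z. \<Sum>i\<in>I. h i z) x = (\<Sum>i\<in>I. avg (h i) x)"
  unfolding avg_def sum_distrib_left by (rule sum.swap)

lemma avg_translate:
  assumes "x \<in> carrier B3Z" "g \<in> carrier B3Z"
  shows "avg (\<lambda>z. h (z \<otimes>\<^bsub>B3Z\<^esub> g)) x = avg h (x \<otimes>\<^bsub>B3Z\<^esub> g)"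
  unfolding avg_def using assms by (intro sum.cong) (auto simp: Sig_closed Z.m_assoc)

lemma avg_tendsto:
  assumes "x \<in> carrier B3Z" "\<And>z. z \<in> carrier B3Z \<Longrightarrow> (\<lambda>n. h n z) \<longlonglongrightarrow> L z"
  shows "(\<lambda>n. avg (h n) x) \<longlonglongrightarrow> avg L x"
  unfolding avg_def using assms by (intro tendsto_sum tendsto_mult_left) (auto simp: Sig_closed)

end

section \<open>Maximum principle and limits of iterates\<close>

locale generating_law = step_law +
  assumes gen: "(\<Union>n. set_pmf (conv_pow \<mu> n)) = carrier B3Z"
begin

text \<open>Decay makes a positive supremum a maximum. Where it is attained, the average forces it
  at every neighbour of positive weight, hence on the whole group because \<open>\<mu>\<close>
  generates; as the group is infinite, this contradicts decay.\<close>

lemma maximum_principle: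
  assumes decays: "decays h"
    and sub: "\<And>x. x \<in> carrier B3Z \<Longrightarrow> 0 < h x \<Longrightarrow> h x \<le> avg h x"
    and x0: "x0 \<in> carrier B3Z"
  shows "h x0 \<le> 0"
proof (rule ccontr)
  assume "\<not> h x0 \<le> 0"
  then have pos: "h x0 > 0" by simp
  define S where "S = {x \<in> carrier B3Z. h x0 \<le> h x}"
  have S: "finite S" "x0 \<in> S" using decays pos x0 by (auto simp: decays_def S_def)
  define m where "m = Max (h ` S)"
  have "m \<in> h ` S" unfolding m_def using S by (intro Max_in) auto
  then obtain z where z: "z \<in> carrier B3Z" "h z = m" by (auto simp: S_def)
  have "h x0 \<le> m" unfolding m_def using S by (intro Max_ge) auto
  then have m: "m > 0" using pos by simp
  have le: "h x \<le> m" if "x \<in> carrier B3Z" for x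
  proof (cases "x \<in> S")
    case True
    then show ?thesis unfolding m_def using S by (intro Max_ge) auto
  next
    case False
    then show ?thesis using that \<open>h x0 \<le> m\<close> by (auto simp: S_def)
  qed
  have reach: "h (inv\<^bsub>B3Z\<^esub> g \<otimes>\<^bsub>B3Z\<^esub> z) = m" if "g \<in> set_pmf (conv_pow \<mu> n)" for n g
    using that
  proof (induction n arbitrary: g)
    case 0
    then show ?case using z by simp
  next
    case (Suc n)
    then obtain g' s where g: "g = g' \<otimes>\<^bsub>B3Z\<^esub> s" "g' \<in> set_pmf (conv_pow \<mu> n)" "s \<in> set_pmf \<mu>" by auto
    have closed: "g' \<in> carrier B3Z" "s \<in> Sig" "s \<in> carrier B3Z"
      using g conv_pow_closed[OF supp_carrier, of n] supp Sig_closed by auto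
    let ?x = "inv\<^bsub>B3Z\<^esub> g' \<otimes>\<^bsub>B3Z\<^esub> z"
    have x: "?x \<in> carrier B3Z" using closed z by simp
    have hx: "h ?x = m" using Suc.IH[OF g(2)] .
    have nonneg: "pmf \<mu> t * (m - h (inv\<^bsub>B3Z\<^esub> t \<otimes>\<^bsub>B3Z\<^esub> ?x)) \<ge> 0" if "t \<in> Sig" for t
      using le[of "inv\<^bsub>B3Z\<^esub> t \<otimes>\<^bsub>B3Z\<^esub> ?x"] x Sig_closed[OF that] by (intro mult_nonneg_nonneg) auto
    have "(\<Sum>t\<in>Sig. pmf \<mu> t * (m - h (inv\<^bsub>B3Z\<^esub> t \<otimes>\<^bsub>B3Z\<^esub> ?x))) = m - avg h ?x"
      using sum_pmf by (simp add: avg_def right_diff_distrib sum_subtractf flip: sum_distrib_right)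
    also have "\<dots> \<le> 0" using sub[OF x] hx m by simp
    finally have "(\<Sum>t\<in>Sig. pmf \<mu> t * (m - h (inv\<^bsub>B3Z\<^esub> t \<otimes>\<^bsub>B3Z\<^esub> ?x))) = 0"
      using nonneg by (intro antisym sum_nonneg) auto
    then have "pmf \<mu> s * (m - h (inv\<^bsub>B3Z\<^esub> s \<otimes>\<^bsub>B3Z\<^esub> ?x)) = 0"
      using sum_nonneg_eq_0_iff[OF finite_Sig nonneg] closed by simp
    then have "h (inv\<^bsub>B3Z\<^esub> s \<otimes>\<^bsub>B3Z\<^esub> ?x) = m" using g(3) by (simp add: set_pmf_iff)
    then show ?case using closed z by (simp add: g(1) Z.inv_mult_group Z.m_assoc)
  qed
  have "h x = m" if x: "x \<in> carrier B3Z" for x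
  proof -
    \<comment> \<open>The element whose inverse carries \<open>z\<close> to \<open>x\<close> is
      \<open>z x^-1\<close>.\<close>
    have "z \<otimes>\<^bsub>B3Z\<^esub> inv\<^bsub>B3Z\<^esub> x \<in> (\<Union>n. set_pmf (conv_pow \<mu> n))" unfolding gen using x z by simp
    then have "h (inv\<^bsub>B3Z\<^esub> (z \<otimes>\<^bsub>B3Z\<^esub> inv\<^bsub>B3Z\<^esub> x) \<otimes>\<^bsub>B3Z\<^esub> z) = m" using reach by blast
    then show ?thesis using x z by (simp add: Z.inv_mult_group Z.m_assoc)
  qed
  then have "{x \<in> carrier B3Z. m \<le> h x} = carrier B3Z" by auto
  moreover have "finite {x \<in> carrier B3Z. m \<le> h x}" using decays m by (simp add: decays_def)
  ultimately show False using infinite_carrier by simp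
qed

text \<open>The limit solves the same equation and lies below \<open>H\<close>, so that \<open>H\<close> minus the limit decays and the
  maximum principle applies to it.\<close>

lemma increasing_limit:
  assumes "decays H"
    and H: "\<And>x. x \<in> carrier B3Z \<Longrightarrow> x \<notin> K \<Longrightarrow> H x = b x + avg H x"
    and le: "\<And>n x. x \<in> carrier B3Z \<Longrightarrow> h n x \<le> h (Suc n) x"
    and bound: "\<And>n x. x \<in> carrier B3Z \<Longrightarrow> h n x \<le> H x"
    and step: "\<And>n x. x \<in> carrier B3Z \<Longrightarrow> x \<notin> K \<Longrightarrow> h (Suc n) x = b x + avg (h n) x"
    and K: "\<And>n x. x \<in> carrier B3Z \<Longrightarrow> x \<in> K \<Longrightarrow> h (Suc n) x = H x"
    and nonneg: "\<And>x. x \<in> carrier B3Z \<Longrightarrow> h 0 x \<ge> 0"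
    and x: "x \<in> carrier B3Z"
  shows "(\<lambda>n. h n x) \<longlonglongrightarrow> H x"
proof -
  define L where "L z = (SUP n. h n z)" for z
  have inc: "incseq (\<lambda>n. h n z)" if "z \<in> carrier B3Z" for z
    using le[OF that] by (rule incseq_SucI)
  have L: "(\<lambda>n. h n z) \<longlonglongrightarrow> L z" if "z \<in> carrier B3Z" for z
    unfolding L_def using inc[OF that] bound[OF that] by (intro LIMSEQ_incseq_SUP) (auto intro!: bdd_aboveI2)
  have L0: "L z \<ge> 0" if "z \<in> carrier B3Z" for z
    using incseq_le[OF inc[OF that] L[OF that], of 0] nonneg[OF that] by linarith
  have L_Suc: "(\<lambda>n. h (Suc n) z) \<longlonglongrightarrow> L z" if "z \<in> carrier B3Z" for z
    using LIMSEQ_Suc[OF L[OF that]] .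
  have LK: "L z = H z" if "z \<in> carrier B3Z" "z \<in> K" for z
    using L_Suc[OF that(1)] K[OF that] by (simp add: LIMSEQ_const_iff)
  have L_eq: "L z = b z + avg L z" if "z \<in> carrier B3Z" "z \<notin> K" for z
  proof (rule LIMSEQ_unique)
    show "(\<lambda>n. h (Suc n) z) \<longlonglongrightarrow> L z" using L_Suc that by blast
    show "(\<lambda>n. h (Suc n) z) \<longlonglongrightarrow> b z + avg L z"
      unfolding step[OF that] using that L by (intro tendsto_add tendsto_const avg_tendsto) auto
  qed
  have "H z - L z \<le> 0" if "z \<in> carrier B3Z" for z
  proof (rule maximum_principle[OF _ _ that])
    show "decays (\<lambda>z. H z - L z)" using L0 by (intro decays_mono[OF \<open>decays H\<close>]) auto
    \<comment> \<open>On \<open>K\<close> the difference is zero, so positivity puts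
      \<open>z\<close> off \<open>K\<close>, where the source term \<open>b\<close> cancels.\<close>
    show "H z - L z \<le> avg (\<lambda>z. H z - L z) z" if "z \<in> carrier B3Z" "0 < H z - L z" for z
    proof -
      have "z \<notin> K" using that LK by auto
      then show ?thesis using H L_eq that by (simp add: avg_diff)
    qed
  qed
  moreover have "L z \<le> H z" if "z \<in> carrier B3Z" for z
    using L[OF that] bound[OF that] by (intro LIMSEQ_le_const2) auto
  ultimately have "L x = H x" using x by (metis antisym diff_le_0_iff_le)
  then show ?thesis using L[OF x] by simp
qed

text \<open>The iterates start at the indicator of \<open>1\<close>, which is below
  \<open>H\<close>; they increase, and averaging preserves the bound, so
  \<open>increasing_limit\<close> applies with zero source term.\<close>

lemma hit_prob_tendsto:
  assumes "decays H" "\<one>\<^bsub>B3Z\<^esub> \<in> K"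
    and H: "\<And>x. x \<in> carrier B3Z \<Longrightarrow> x \<notin> K \<Longrightarrow> H x = avg H x"
    and K: "\<And>x. x \<in> carrier B3Z \<Longrightarrow> x \<in> K \<Longrightarrow> H x = of_bool (x = \<one>\<^bsub>B3Z\<^esub>)"
    and H0: "\<And>x. x \<in> carrier B3Z \<Longrightarrow> H x \<ge> 0"
    and x: "x \<in> carrier B3Z"
  shows "(\<lambda>n. hit_prob K n x) \<longlonglongrightarrow> H x"
proof (rule increasing_limit[where K = K and b = "\<lambda>_. 0", OF assms(1) _ _ _ _ _ _ x])
  have nonneg: "hit_prob K n z \<ge> 0" for n z
  proof (induction n arbitrary: z)
    case (Suc n)
    then show ?case by (auto simp: avg_def intro!: sum_nonneg)
  qed simp
  show "hit_prob K n z \<le> hit_prob K (Suc n) z" if "z \<in> carrier B3Z" for n z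
    using that
  proof (induction n arbitrary: z)
    case 0
    have "avg (hit_prob K 0) z \<ge> 0" unfolding avg_def using nonneg by (intro sum_nonneg) auto
    then show ?case using assms(2) by auto
  next
    case (Suc n)
    then have "avg (hit_prob K n) z \<le> avg (hit_prob K (Suc n)) z" by (intro avg_mono) auto
    then show ?case by auto
  qed
  show "hit_prob K n z \<le> H z" if "z \<in> carrier B3Z" for n z
    using that
  proof (induction n arbitrary: z)
    case 0
    then show ?case using H0 K assms(2) by (auto simp: of_bool_def)
  next
    case (Suc n)
    then have "avg (hit_prob K n) z \<le> avg H z" by (intro avg_mono) auto
    then show ?case using H K Suc.prems by auto
  qed
qed (use H K in auto)

end

section \<open>Solutions of the Traffic Equations\<close>

lemma sum_bool: "(\<Sum>b\<in>UNIV. h b) = h e + h (\<not> e)" for h :: "bool \<Rightarrow> real"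
  by (cases e) (simp_all add: UNIV_bool)

lemma finite_short_code:
  "finite {x \<in> carrier B3Z. \<exists>e ss f. code x = mk e ss f \<and> length ss \<le> N}"
proof -
  let ?I = "(UNIV :: bool set) \<times> {ss. set ss \<subseteq> (UNIV :: bool set) \<and> length ss \<le> N} \<times> (UNIV :: bool set)"
  have "finite ?I" by (intro finite_cartesian_product finite_lists_length_le) auto
  then have "finite ((\<lambda>(e, ss, f). decode (mk e ss f)) ` ?I)" by (rule finite_imageI)
  moreover have "{x \<in> carrier B3Z. \<exists>e ss f. code x = mk e ss f \<and> length ss \<le> N}
      \<subseteq> (\<lambda>(e, ss, f). decode (mk e ss f)) ` ?I"
  proof
    fix x assume "x \<in> {x \<in> carrier B3Z. \<exists>e ss f. code x = mk e ss f \<and> length ss \<le> N}"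
    then obtain e ss f where "x \<in> carrier B3Z" "code x = mk e ss f" "length ss \<le> N" by blast
    then have "x = decode (mk e ss f)" using decode_code by metis
    then show "x \<in> (\<lambda>(e, ss, f). decode (mk e ss f)) ` ?I" using \<open>length ss \<le> N\<close> by force
  qed
  ultimately show ?thesis by (rule rev_finite_subset)
qed

text \<open>Transfer-matrix form of the sum of \<open>q(u_1) ... q(u_k)\<close> over
  \<open>paths e ss f\<close>.\<close>

fun path_weight :: "(b3z \<Rightarrow> real) \<Rightarrow> bool list \<Rightarrow> bool \<Rightarrow> bool \<Rightarrow> real" where
  "path_weight q [] f e = of_bool (e = f)"
| "path_weight q (s # ss) f e = (\<Sum>g\<in>UNIV. q (elt e s g) * path_weight q ss f (\<not> g))"

fun nf_weight :: "(b3z \<Rightarrow> real) \<Rightarrow> nf \<Rightarrow> real" where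
  "nf_weight q (Tip f) = of_bool (\<not> f)"
| "nf_weight q (Node e s ss f) = path_weight q (s # ss) f e"

lemma nf_weight_mk: "nf_weight q (mk e ss f) = path_weight q ss f e"
  by (cases ss) auto

text \<open>Multiplying the last factor by \<open>\<Delta>\<close> toggles the final exponent, so
  the terms with \<open>\<alpha>\<close> form the weight of the same signs with
  \<open>\<not> f\<close>.\<close>

lemma sum_paths:
  "(\<Sum>us\<in>paths e (s # ss) f. prod_list (map q (butlast us)) * (q (last us) + q (last us \<otimes>\<^bsub>B3Z\<^esub> \<Delta>) * \<alpha>))
    = path_weight q (s # ss) f e + path_weight q (s # ss) (\<not> f) e * \<alpha>" (is "?L e s ss = _")
proof (induction ss arbitrary: e s)
  case Nil
  have "paths e [s] f = {[elt e s (\<not> f)]}" by (auto split: if_splits)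
  then show ?case by (cases f) (simp_all add: UNIV_bool)
next
  case (Cons t ts)
  let ?w = "\<lambda>us. prod_list (map q (butlast us)) * (q (last us) + q (last us \<otimes>\<^bsub>B3Z\<^esub> \<Delta>) * \<alpha>)"
  let ?P = "\<lambda>g. paths (\<not> g) (t # ts) f"
  have "?L e s (t # ts) = (\<Sum>g\<in>UNIV. \<Sum>us\<in>(#) (elt e s g) ` ?P g. ?w us)"
    unfolding paths.simps(2)[of e] by (rule sum.UNION_disjoint) auto
  also have "\<dots> = (\<Sum>g\<in>UNIV. \<Sum>us\<in>?P g. ?w (elt e s g # us))"
    by (rule sum.cong[OF HOL.refl], subst sum.reindex) (auto simp: inj_on_def)
  also have "\<dots> = (\<Sum>g\<in>UNIV. \<Sum>us\<in>?P g. q (elt e s g) * ?w us)"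
  proof (intro sum.cong HOL.refl)
    fix g us assume "us \<in> ?P g"
    then have "us \<noteq> []" using length_paths by fastforce
    then show "?w (elt e s g # us) = q (elt e s g) * ?w us" by simp
  qed
  also have "\<dots> = (\<Sum>g\<in>UNIV. q (elt e s g) *
      (path_weight q (t # ts) f (\<not> g) + path_weight q (t # ts) (\<not> f) (\<not> g) * \<alpha>))"
    unfolding Cons.IH[symmetric] sum_distrib_left ..
  also have "\<dots> = path_weight q (s # t # ts) f e + path_weight q (s # t # ts) (\<not> f) e * \<alpha>"
    unfolding path_weight.simps(2)[of q s "t # ts"]
    by (simp only: distrib_left sum.distrib sum_distrib_right mult.assoc)
  finally show ?case .
qed

section \<open>Harmonicity and decay of \<open>H\<close>\<close>

locale traffic_solution = generating_law +
  fixes r :: "b3z \<Rightarrow> real"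
  assumes r_pos: "u \<in> Sig \<Longrightarrow> 0 < r u"
    and r_traffic: "traffic_equations \<mu> r"
begin

text \<open>For \<open>u\<close> with trailing exponent \<open>g\<close>, \<open>r(Next u)\<close>
  is \<open>R (\<not> g)\<close>.\<close>

definition R :: "bool \<Rightarrow> real" where
  "R e = (\<Sum>s\<in>UNIV. \<Sum>g\<in>UNIV. r (elt e s g))"

definition q :: "b3z \<Rightarrow> real" where
  "q u = r u / sum r (Next u)"

definition H :: "b3z \<Rightarrow> real" where
  "H x = nf_weight q (code x)"

lemma R_pos: "R e > 0"
  unfolding R_def by (intro sum_pos r_pos) auto

lemma q_elt: "q (elt e s g) = r (elt e s g) / R (\<not> g)"
  by (simp add: q_def sum_Next R_def)

lemma q_pos: "u \<in> Sig \<Longrightarrow> q u > 0"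
  by (auto elim!: SigE simp: q_elt R_pos r_pos)

lemma r_elt: "r (elt e s g) = q (elt e s g) * R (\<not> g)"
  using R_pos[of "\<not> g"] by (simp add: q_elt)

text \<open>All terms of the Traffic Equation at \<open>u\<close> carry the same last letter, so that the factor
  \<open>r(Next u)\<close> cancels; what remains is the first passage decomposition for \<open>q\<close>.\<close>

lemma q_equation:
  "q (elt e s f) = pmf \<mu> (elt e s f)
    + (\<Sum>g\<in>UNIV. pmf \<mu> (elt e (\<not> s) g) * q (elt g (\<not> s) f))
    + (\<Sum>t\<in>UNIV. \<Sum>g\<in>UNIV. pmf \<mu> (elt (\<not> e) t g) *
        (q (elt g (\<not> t) (\<not> e)) * q (elt e s f) + q (elt g (\<not> t) e) * q (elt (\<not> e) s f)))"
    (is "_ = ?rhs")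
proof -
  let ?u = "elt e s f"
  have F: "Fset ?u - {?u, ?u \<otimes>\<^bsub>B3Z\<^esub> \<Delta>} = range (\<lambda>g. elt e (\<not> s) g)"
  proof (intro Set.equalityI subsetI)
    fix v assume v: "v \<in> Fset ?u - {?u, ?u \<otimes>\<^bsub>B3Z\<^esub> \<Delta>}"
    then obtain t h where "v = elt e t h" by (auto simp: Fset_elt)
    with v have "v = elt e (\<not> s) h" by simp blast
    then show "v \<in> range (\<lambda>g. elt e (\<not> s) g)" by blast
  next
    fix v assume "v \<in> range (\<lambda>g. elt e (\<not> s) g)"
    then obtain g where "v = elt e (\<not> s) g" by blast
    then show "v \<in> Fset ?u - {?u, ?u \<otimes>\<^bsub>B3Z\<^esub> \<Delta>}" by (simp add: Fset_def)
  qed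
  have S: "Sig - Fset ?u = (\<lambda>(t, g). elt (\<not> e) t g) ` UNIV"
    by (auto simp: Fset_elt Sig_elt image_iff split_paired_Ex)
  \<comment> \<open>The factor \<open>elt g s e\<close> is the inverse of
    \<open>v = elt e (\<not> s) g\<close>; the two powers of \<open>c\<close> merge into the
    opposite sign.\<close>
  have mult: "elt g s e \<otimes>\<^bsub>B3Z\<^esub> ?u = elt g (\<not> s) f" for g
    using elt_mult_mk(2)[of ?u e "[s]" "\<not> f" e s "[]" g s] by (intro code_eqI) auto
  have "r ?u = pmf \<mu> ?u * sum r (Next ?u)
    + (\<Sum>v\<in>Fset ?u - {?u, ?u \<otimes>\<^bsub>B3Z\<^esub> \<Delta>}. pmf \<mu> v * r (inv\<^bsub>B3Z\<^esub> v \<otimes>\<^bsub>B3Z\<^esub> ?u))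
    + (\<Sum>v\<in>Sig - Fset ?u. pmf \<mu> v *
        (q (inv\<^bsub>B3Z\<^esub> v) * r ?u + q (inv\<^bsub>B3Z\<^esub> v \<otimes>\<^bsub>B3Z\<^esub> \<Delta>) * r (iota ?u \<otimes>\<^bsub>B3Z\<^esub> \<Delta>)))"
    using r_traffic unfolding traffic_equations_def q_def by (rule bspec) simp
  also have "(\<Sum>v\<in>Fset ?u - {?u, ?u \<otimes>\<^bsub>B3Z\<^esub> \<Delta>}. pmf \<mu> v * r (inv\<^bsub>B3Z\<^esub> v \<otimes>\<^bsub>B3Z\<^esub> ?u))
    = (\<Sum>g\<in>UNIV. pmf \<mu> (elt e (\<not> s) g) * r (elt g (\<not> s) f))"
    unfolding F by (subst sum.reindex) (auto simp: inj_on_def mult)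
  also have "(\<Sum>v\<in>Sig - Fset ?u. pmf \<mu> v *
        (q (inv\<^bsub>B3Z\<^esub> v) * r ?u + q (inv\<^bsub>B3Z\<^esub> v \<otimes>\<^bsub>B3Z\<^esub> \<Delta>) * r (iota ?u \<otimes>\<^bsub>B3Z\<^esub> \<Delta>)))
    = (\<Sum>t\<in>UNIV. \<Sum>g\<in>UNIV. pmf \<mu> (elt (\<not> e) t g) *
        (q (elt g (\<not> t) (\<not> e)) * r ?u + q (elt g (\<not> t) e) * r (elt (\<not> e) s f)))"
    unfolding S by (subst sum.reindex)
      (auto simp: inj_on_def sum.cartesian_product UNIV_Times_UNIV case_prod_unfold)
  also have "sum r (Next ?u) = R (\<not> f)" by (simp add: sum_Next R_def)
  finally have "q ?u * R (\<not> f) = ?rhs * R (\<not> f)"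
    unfolding r_elt by (simp add: UNIV_bool algebra_simps)
  then show ?thesis using R_pos[of "\<not> f"] by simp
qed

lemma H_mk: "code x = mk e ss f \<Longrightarrow> H x = path_weight q ss f e"
  by (simp add: H_def nf_weight_mk)

lemma H_elt [simp]: "H (elt e s g) = q (elt e s g)"
proof -
  have "H (elt e s g) = path_weight q [s] (\<not> g) e" by (rule H_mk) simp
  then show ?thesis by (cases g) (simp_all add: UNIV_bool)
qed

lemma H_one [simp]: "H \<one>\<^bsub>B3Z\<^esub> = 1" and H_Delta [simp]: "H \<Delta> = 0"
  by (simp_all add: H_def)

lemma path_weight_nonneg: "path_weight q ss f e \<ge> 0"
proof (induction ss arbitrary: e)
  case (Cons s ss)
  have "q (elt e s g) \<ge> 0" for g using q_pos[of "elt e s g"] by simp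
  then show ?case unfolding path_weight.simps by (intro sum_nonneg mult_nonneg_nonneg Cons)
qed simp

lemma H_nonneg: "H x \<ge> 0"
proof -
  obtain e ss f where "code x = mk e ss f" using mk_exhaust by blast
  then show ?thesis using path_weight_nonneg by (simp add: H_mk)
qed

lemma code_cases:
  assumes "x \<in> carrier B3Z" "x \<notin> {\<one>\<^bsub>B3Z\<^esub>, \<Delta>}"
  obtains e s ss f where "code x = mk e (s # ss) f"
proof -
  obtain e ss f where *: "code x = mk e ss f" using mk_exhaust by blast
  have "ss \<noteq> []"
  proof
    assume "ss = []"
    then have "code x = code \<one>\<^bsub>B3Z\<^esub> \<or> code x = code \<Delta>" using * by (cases e; cases f) simp_all
    then have "x = \<one>\<^bsub>B3Z\<^esub> \<or> x = \<Delta>" using code_inject[of x "\<one>\<^bsub>B3Z\<^esub>"] code_inject[of x \<Delta>] assms(1) by simp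
    then show False using assms(2) by simp
  qed
  with * that show ?thesis by (cases ss) auto
qed

text \<open>After the first sign is split off, the coefficient of each tail weight in
  \<open>avg H x\<close> is the right side of \<open>q_equation\<close>, so the average rebuilds the
  path weight of \<open>x\<close>.\<close>

lemma H_harmonic:
  assumes x: "x \<in> carrier B3Z" "x \<notin> {\<one>\<^bsub>B3Z\<^esub>, \<Delta>}"
  shows "H x = avg H x"
proof -
  obtain e s ss f where c: "code x = mk e (s # ss) f" using code_cases[OF x] .
  note mult = elt_mult_mk[OF x(1) c]
  let ?w = "path_weight q"
  \<comment> \<open>A step deletes the first sign, flips it, or puts a new sign before it.\<close>
  have 1: "H (elt g (\<not> s) e \<otimes>\<^bsub>B3Z\<^esub> x) = ?w ss f (\<not> g)" for g
    by (rule H_mk) (subst mult(2), auto simp del: mk.simps)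
  have 2: "H (elt g s e \<otimes>\<^bsub>B3Z\<^esub> x) = ?w ((\<not> s) # ss) f g" for g
    by (rule H_mk) (subst mult(2), auto simp del: mk.simps)
  have 3: "H (elt g t (\<not> e) \<otimes>\<^bsub>B3Z\<^esub> x) = ?w (t # s # ss) f g" for g t
    by (rule H_mk) (subst mult(1), auto simp del: mk.simps)
  have "avg H x = (\<Sum>d\<in>UNIV. \<Sum>t\<in>UNIV. \<Sum>g\<in>UNIV. pmf \<mu> (elt d t g) * H (elt g (\<not> t) d \<otimes>\<^bsub>B3Z\<^esub> x))"
    by (simp add: avg_def sum_Sig)
  also have "\<dots> = (\<Sum>g\<in>UNIV. pmf \<mu> (elt e s g) * ?w ss f (\<not> g))
      + (\<Sum>g\<in>UNIV. pmf \<mu> (elt e (\<not> s) g) * ?w ((\<not> s) # ss) f g)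
      + (\<Sum>t\<in>UNIV. \<Sum>g\<in>UNIV. pmf \<mu> (elt (\<not> e) t g) * ?w ((\<not> t) # s # ss) f g)"
  proof -
    have "(\<Sum>t\<in>UNIV. \<Sum>g\<in>UNIV. pmf \<mu> (elt e t g) * H (elt g (\<not> t) e \<otimes>\<^bsub>B3Z\<^esub> x))
      = (\<Sum>g\<in>UNIV. pmf \<mu> (elt e s g) * ?w ss f (\<not> g))
        + (\<Sum>g\<in>UNIV. pmf \<mu> (elt e (\<not> s) g) * ?w ((\<not> s) # ss) f g)"
      by (subst sum_bool[of _ s]) (simp only: 1 2 not_not)
    then show ?thesis
      by (subst sum_bool[of _ e]) (simp only: 3)
  qed
  \<comment> \<open>The weights are expanded down to the tail \<open>ss\<close> and sorted by the
    exponent \<open>k\<close> in front of it.\<close>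
  also have "\<dots> = (\<Sum>k\<in>UNIV. (pmf \<mu> (elt e s k)
    + (\<Sum>g\<in>UNIV. pmf \<mu> (elt e (\<not> s) g) * q (elt g (\<not> s) k))
    + (\<Sum>t\<in>UNIV. \<Sum>g\<in>UNIV. pmf \<mu> (elt (\<not> e) t g) *
        (q (elt g (\<not> t) (\<not> e)) * q (elt e s k) + q (elt g (\<not> t) e) * q (elt (\<not> e) s k)))) * ?w ss f (\<not> k))"
    by (cases e) (simp_all add: UNIV_bool algebra_simps)
  also have "\<dots> = ?w (s # ss) f e"
    unfolding q_equation[symmetric] by simp
  finally show ?thesis using H_mk[OF c] by simp
qed

text \<open>\<open>R\<close> controls the transfer recursion:
  \<open>q u * R (\<not> g) = r u\<close> for \<open>u = elt e s g\<close>, so one sign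
  \<open>s\<close> replaces \<open>R e\<close> by the part of this mass carried by \<open>s\<close>.
  Both signs carry positive mass, hence each share is below 1.\<close>

lemma path_weight_decays:
  obtains \<rho> \<kappa> where "0 \<le> \<rho>" "\<rho> < 1" "\<And>ss f e. path_weight q ss f e \<le> \<kappa> * \<rho> ^ length ss"
proof -
  define a where "a e s = (\<Sum>g\<in>UNIV. r (elt e s g)) / R e" for e s
  have a_pos: "a e s > 0" for e s
    unfolding a_def using R_pos by (intro divide_pos_pos sum_pos r_pos) auto
  have "a e s + a e (\<not> s) = 1" for e s
  proof -
    have "R e = (\<Sum>g\<in>UNIV. r (elt e s g)) + (\<Sum>g\<in>UNIV. r (elt e (\<not> s) g))"
      unfolding R_def by (rule sum_bool)
    then show ?thesis using R_pos[of e] unfolding a_def by (simp flip: add_divide_distrib)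
  qed
  from this a_pos have a_less: "a e s < 1" for e s
    by (metis less_add_same_cancel1)
  define \<rho> where "\<rho> = Max (range (\<lambda>(e, s). a e s))"
  have "\<rho> \<in> range (\<lambda>(e, s). a e s)" unfolding \<rho>_def by (intro Max_in) auto
  then have \<rho>: "0 \<le> \<rho>" "\<rho> < 1" using a_pos a_less by (auto intro: less_imp_le)
  have a_le: "a e s \<le> \<rho>" for e s
    unfolding \<rho>_def by (intro Max_ge) (auto intro: image_eqI[of _ _ "(e, s)"])
  \<comment> \<open>Large enough that \<open>\<kappa>' * R e\<close> dominates the weight of the
    empty path.\<close>
  define \<kappa>' where "\<kappa>' = 1 / R True + 1 / R False"
  have \<kappa>': "\<kappa>' \<ge> 0" "1 \<le> \<kappa>' * R e" for e
    using R_pos[of True] R_pos[of False] by (cases e; simp add: \<kappa>'_def field_simps)+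
  have *: "path_weight q ss f e \<le> \<kappa>' * \<rho> ^ length ss * R e" for ss f e
  proof (induction ss arbitrary: e)
    case Nil
    have "of_bool (e = f) \<le> (1 :: real)" by simp
    also note \<kappa>'(2)[of e]
    finally show ?case by simp
  next
    case (Cons s ss)
    have "path_weight q (s # ss) f e \<le> (\<Sum>g\<in>UNIV. q (elt e s g) * (\<kappa>' * \<rho> ^ length ss * R (\<not> g)))"
      unfolding path_weight.simps using q_pos
      by (intro sum_mono mult_left_mono Cons.IH) (auto intro: less_imp_le)
    also have "\<dots> = \<kappa>' * \<rho> ^ length ss * (\<Sum>g\<in>UNIV. r (elt e s g))"
      unfolding sum_distrib_left r_elt by (simp add: mult_ac)
    also have "\<dots> = \<kappa>' * \<rho> ^ length ss * (a e s * R e)"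
      using R_pos[of e] by (simp add: a_def)
    also have "\<dots> \<le> \<kappa>' * \<rho> ^ length ss * (\<rho> * R e)"
      using \<rho> \<kappa>' R_pos[of e] a_le[of e s]
      by (intro mult_left_mono mult_right_mono) auto
    finally show ?case by (simp add: mult_ac)
  qed
  have "path_weight q ss f e \<le> (\<kappa>' * (R True + R False)) * \<rho> ^ length ss" for ss f e
  proof -
    have "\<kappa>' * \<rho> ^ length ss * R e \<le> \<kappa>' * \<rho> ^ length ss * (R True + R False)"
      using \<rho> \<kappa>'(1) R_pos[of True] R_pos[of False] by (intro mult_left_mono) (cases e, auto)
    then show ?thesis using *[of ss f e] by (simp add: mult_ac)
  qed
  with \<rho> that show ?thesis by blast
qed

lemma H_decays: "decays H"
  unfolding decays_def
proof (intro allI impI)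
  fix \<epsilon> :: real assume "\<epsilon> > 0"
  obtain \<rho> \<kappa> where \<rho>: "0 \<le> \<rho>" "\<rho> < 1" and le: "\<And>ss f e. path_weight q ss f e \<le> \<kappa> * \<rho> ^ length ss"
    using path_weight_decays by blast
  have "(\<lambda>n. \<kappa> * \<rho> ^ n) \<longlonglongrightarrow> \<kappa> * 0"
    using \<rho> by (intro tendsto_mult_left LIMSEQ_realpow_zero) auto
  then have "eventually (\<lambda>n. \<kappa> * \<rho> ^ n < \<epsilon>) sequentially"
    using \<open>\<epsilon> > 0\<close> by (intro order_tendstoD) auto
  then obtain N where N: "\<And>n. n \<ge> N \<Longrightarrow> \<kappa> * \<rho> ^ n < \<epsilon>" by (auto simp: eventually_sequentially)
  have "{x \<in> carrier B3Z. \<epsilon> \<le> H x} \<subseteq> {x \<in> carrier B3Z. \<exists>e ss f. code x = mk e ss f \<and> length ss \<le> N}"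
  proof safe
    fix x assume "x \<in> carrier B3Z" "\<epsilon> \<le> H x"
    obtain e ss f where c: "code x = mk e ss f" using mk_exhaust by blast
    have "length ss \<le> N"
    proof (rule ccontr)
      assume "\<not> length ss \<le> N"
      then have "\<kappa> * \<rho> ^ length ss < \<epsilon>" by (intro N) auto
      then show False using \<open>\<epsilon> \<le> H x\<close> H_mk[OF c] le[of ss f e] by simp
    qed
    then show "\<exists>e ss f. code x = mk e ss f \<and> length ss \<le> N" using c by blast
  qed
  then show "finite {x \<in> carrier B3Z. \<epsilon> \<le> H x}" using finite_short_code finite_subset by blast
qed

section \<open>Hitting probabilities, transience and the Green function\<close>

lemma hit_coset_tendsto:
  "x \<in> carrier B3Z \<Longrightarrow> (\<lambda>n. hit_prob {\<one>\<^bsub>B3Z\<^esub>, \<Delta>} n x) \<longlonglongrightarrow> H x"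
  using H_decays H_harmonic H_nonneg code_inject[of \<Delta> "\<one>\<^bsub>B3Z\<^esub>"] by (intro hit_prob_tendsto) auto

text \<open>Elements of \<open>\<Sigma>\<close> avoid \<open>{1, \<Delta>}\<close>, so
  \<open>H\<close> is harmonic there; with \<open>qhat = avg H\<close> this becomes the first
  claim.\<close>

lemma avg_H_Sig: "u \<in> Sig \<Longrightarrow> avg H u = q u"
proof -
  assume u: "u \<in> Sig"
  then obtain e s g where u': "u = elt e s g" by (rule SigE)
  then have "u \<notin> {\<one>\<^bsub>B3Z\<^esub>, \<Delta>}"
    using code_inject[of u "\<one>\<^bsub>B3Z\<^esub>"] code_inject[of u \<Delta>] by auto
  then show "avg H u = q u" using H_harmonic[of u] by (simp add: u')
qed

lemma avg_H_one: "avg H \<one>\<^bsub>B3Z\<^esub> = (\<Sum>u\<in>Sig. pmf \<mu> u * q (inv\<^bsub>B3Z\<^esub> u))"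
  unfolding avg_def by (intro sum.cong) (auto elim!: SigE)

lemma avg_H_Delta: "avg H \<Delta> = (\<Sum>u\<in>Sig. pmf \<mu> u * q (inv\<^bsub>B3Z\<^esub> u \<otimes>\<^bsub>B3Z\<^esub> \<Delta>))"
  unfolding avg_def by (intro sum.cong) (auto elim!: SigE)

text \<open>The value that \<open>Q(\<Delta>)\<close> turns out to have.\<close>

definition \<alpha> :: real where
  "\<alpha> = avg H \<Delta> / (1 - avg H \<one>\<^bsub>B3Z\<^esub>)"

text \<open>Either the target \<open>u\<close> is visited before \<open>u \<Delta>\<close>, or
  \<open>u \<Delta>\<close> comes first and \<open>u\<close> is reached from there with probability
  \<open>\<alpha>\<close>.\<close>

definition reach :: "b3z \<Rightarrow> real" where
  "reach x = H x + H (x \<otimes>\<^bsub>B3Z\<^esub> \<Delta>) * \<alpha>"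

lemma mult_Delta_notin:
  assumes "x \<in> carrier B3Z" "x \<notin> {\<one>\<^bsub>B3Z\<^esub>, \<Delta>}"
  shows "x \<otimes>\<^bsub>B3Z\<^esub> \<Delta> \<notin> {\<one>\<^bsub>B3Z\<^esub>, \<Delta>}"
proof
  assume "x \<otimes>\<^bsub>B3Z\<^esub> \<Delta> \<in> {\<one>\<^bsub>B3Z\<^esub>, \<Delta>}"
  then have "(x \<otimes>\<^bsub>B3Z\<^esub> \<Delta>) \<otimes>\<^bsub>B3Z\<^esub> \<Delta> \<in> {\<one>\<^bsub>B3Z\<^esub>, \<Delta>}" by (elim insertE) simp_all
  then show False using assms by (simp add: Z.m_assoc)
qed

text \<open>Both averages evaluate \<open>q\<close> at elements of \<open>\<Sigma>\<close>, where it
  is positive, and \<open>\<mu>\<close> has its whole mass there.\<close>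

lemma avg_H_pos: "avg H \<one>\<^bsub>B3Z\<^esub> > 0" "avg H \<Delta> > 0"
proof -
  have *: "(\<Sum>u\<in>Sig. pmf \<mu> u * h u) > 0" if "\<And>u. u \<in> Sig \<Longrightarrow> h u > 0" for h
  proof -
    have nonneg: "pmf \<mu> u * h u \<ge> 0" if "u \<in> Sig" for u
      using \<open>\<And>u. u \<in> Sig \<Longrightarrow> h u > 0\<close>[OF that] by simp
    have "(\<Sum>u\<in>Sig. pmf \<mu> u * h u) \<noteq> 0"
    proof
      assume "(\<Sum>u\<in>Sig. pmf \<mu> u * h u) = 0"
      then have "pmf \<mu> u = 0" if "u \<in> Sig" for u
        using sum_nonneg_eq_0_iff[OF finite_Sig nonneg] \<open>\<And>u. u \<in> Sig \<Longrightarrow> h u > 0\<close>[OF that] that by force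
      then show False using sum_pmf by simp
    qed
    then show ?thesis using sum_nonneg[of Sig "\<lambda>u. pmf \<mu> u * h u"] nonneg by force
  qed
  show "avg H \<one>\<^bsub>B3Z\<^esub> > 0" unfolding avg_H_one by (intro * q_pos Sig_inv)
  show "avg H \<Delta> > 0" unfolding avg_H_Delta by (intro * q_pos) (auto elim!: SigE)
qed

text \<open>Transience: otherwise the probability of ever hitting the coset \<open>{1, \<Delta>}\<close> would be a decaying
  harmonic function on the whole group.\<close>

lemma avg_H_less_1: "avg H \<one>\<^bsub>B3Z\<^esub> + avg H \<Delta> < 1"
proof (rule ccontr)
  assume ge: "\<not> avg H \<one>\<^bsub>B3Z\<^esub> + avg H \<Delta> < 1"
  define S where "S x = H x + H (x \<otimes>\<^bsub>B3Z\<^esub> \<Delta>)" for x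
  have avg_S: "avg S x = avg H x + avg H (x \<otimes>\<^bsub>B3Z\<^esub> \<Delta>)" if "x \<in> carrier B3Z" for x
    using that unfolding S_def by (simp add: avg_add avg_translate)
  have "S \<one>\<^bsub>B3Z\<^esub> \<le> 0"
  proof (rule maximum_principle)
    show "decays S" unfolding S_def by (intro decays_add decays_translate H_decays) simp
    show "S x \<le> avg S x" if x: "x \<in> carrier B3Z" for x
    proof (cases "x \<in> {\<one>\<^bsub>B3Z\<^esub>, \<Delta>}")
      case True
      \<comment> \<open>On the coset \<open>S\<close> is 1, and \<open>avg S\<close> is
        \<open>avg H 1 + avg H \<Delta>\<close> at both points.\<close>
      then show ?thesis using ge unfolding avg_S[OF x] by (auto simp: S_def)
    next
      case False
      then show ?thesis
        using H_harmonic[OF x False] H_harmonic[OF _ mult_Delta_notin[OF x False]] x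
        unfolding avg_S[OF x] by (simp add: S_def)
    qed
  qed simp
  then show False by (simp add: S_def)
qed

lemma \<alpha>_pos: "\<alpha> > 0"
  using avg_H_pos avg_H_less_1 by (simp add: \<alpha>_def)

text \<open>First-return equation at \<open>\<Delta>\<close>: the next visit to the coset is at the
  target, or at the starting point, and then the search begins anew.\<close>

lemma \<alpha>_eq: "\<alpha> = avg H \<Delta> + avg H \<one>\<^bsub>B3Z\<^esub> * \<alpha>"
  using avg_H_pos avg_H_less_1 by (simp add: \<alpha>_def field_simps)

lemma reach_one [simp]: "reach \<one>\<^bsub>B3Z\<^esub> = 1" and reach_Delta [simp]: "reach \<Delta> = \<alpha>"
  by (simp_all add: reach_def)

lemma reach_nonneg: "reach x \<ge> 0"
  using \<alpha>_pos H_nonneg by (simp add: reach_def)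

lemma reach_decays: "decays reach"
  unfolding reach_def using \<alpha>_pos
  by (subst mult.commute) (intro decays_add decays_cmult decays_translate H_decays, auto)

lemma avg_reach: "x \<in> carrier B3Z \<Longrightarrow> avg reach x = avg H x + avg H (x \<otimes>\<^bsub>B3Z\<^esub> \<Delta>) * \<alpha>"
  unfolding reach_def by (subst mult.commute) (simp add: avg_add avg_cmult avg_translate)

text \<open>At \<open>\<Delta>\<close> this is the choice of \<open>\<alpha>\<close>; off the coset
  both summands are harmonic because the coset is stable under \<open>\<Delta>\<close>.\<close>

lemma reach_harmonic:
  assumes x: "x \<in> carrier B3Z" "x \<noteq> \<one>\<^bsub>B3Z\<^esub>"
  shows "reach x = avg reach x"
proof (cases "x = \<Delta>")
  case True
  then show ?thesis using \<alpha>_eq by (simp add: avg_reach)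
next
  case False
  then have "x \<notin> {\<one>\<^bsub>B3Z\<^esub>, \<Delta>}" using x by simp
  from H_harmonic[OF x(1) this] H_harmonic[OF _ mult_Delta_notin[OF x(1) this]] show ?thesis
    using x by (simp add: avg_reach reach_def)
qed

lemma hit_one_tendsto:
  "x \<in> carrier B3Z \<Longrightarrow> (\<lambda>n. hit_prob {\<one>\<^bsub>B3Z\<^esub>} n x) \<longlonglongrightarrow> reach x"
  using reach_decays reach_harmonic reach_nonneg by (intro hit_prob_tendsto) auto

lemma reach_psi_inv:
  assumes v: "v \<in> carrier B3Z" "v \<notin> {\<one>\<^bsub>B3Z\<^esub>, \<Delta>}"
  shows "reach v = (\<Sum>us\<in>psi_inv v. prod_list (map q (butlast us)) *
    (q (last us) + q (last us \<otimes>\<^bsub>B3Z\<^esub> \<Delta>) * \<alpha>))"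
proof -
  obtain e s ss f where c: "code v = mk e (s # ss) f" using code_cases[OF v] .
  then have "code (v \<otimes>\<^bsub>B3Z\<^esub> \<Delta>) = mk e (s # ss) (\<not> f)" using v by simp
  from H_mk[OF c] H_mk[OF this] show ?thesis
    unfolding psi_inv_mk[OF v(1) c] sum_paths reach_def by simp
qed

text \<open>Solves \<open>\<gamma> = 1 + \<gamma> * p\<close> for the return probability
  \<open>p = avg reach 1\<close>; it is the expected number of visits to the starting point.\<close>

definition \<gamma> :: real where
  "\<gamma> = (1 - avg H \<one>\<^bsub>B3Z\<^esub>) / ((1 - avg H \<one>\<^bsub>B3Z\<^esub>)\<^sup>2 - (avg H \<Delta>)\<^sup>2)"

lemma \<gamma>: "\<gamma> > 0" "\<gamma> = 1 + \<gamma> * avg reach \<one>\<^bsub>B3Z\<^esub>"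
proof -
  define a b where "a = avg H \<one>\<^bsub>B3Z\<^esub>" and "b = avg H \<Delta>"
  have ab: "0 < a" "0 < b" "a + b < 1" using avg_H_pos avg_H_less_1 by (auto simp: a_def b_def)
  then have "b\<^sup>2 < (1 - a)\<^sup>2" by (intro power_strict_mono) auto
  then have d: "(1 - a)\<^sup>2 - b\<^sup>2 > 0" by simp
  have g: "\<gamma> = (1 - a) / ((1 - a)\<^sup>2 - b\<^sup>2)" by (simp add: \<gamma>_def a_def b_def)
  show "\<gamma> > 0" unfolding g using d ab by (intro divide_pos_pos) auto
  have "avg reach \<one>\<^bsub>B3Z\<^esub> = a + b * b / (1 - a)"
    by (simp add: avg_reach \<alpha>_def a_def b_def)
  \<comment> \<open>With \<open>\<alpha> = b / (1 - a)\<close> the escape probability is the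
    reciprocal of \<open>\<gamma>\<close>.\<close>
  then have "1 - avg reach \<one>\<^bsub>B3Z\<^esub> = ((1 - a)\<^sup>2 - b\<^sup>2) / (1 - a)"
    using ab by (simp add: field_simps power2_eq_square)
  then have "\<gamma> * (1 - avg reach \<one>\<^bsub>B3Z\<^esub>) = 1" unfolding g using d ab by simp
  then show "\<gamma> = 1 + \<gamma> * avg reach \<one>\<^bsub>B3Z\<^esub>" by (simp add: right_diff_distrib)
qed

text \<open>Partial sums obey the averaging recursion with the indicator of \<open>1\<close> as
  source, and \<open>\<gamma> * reach\<close> is a decaying fixed point of it on the whole group, so
  \<open>increasing_limit\<close> is used with empty \<open>K\<close>.\<close>

lemma conv_pow_sums:
  assumes x: "x \<in> carrier B3Z"
  shows "(\<lambda>i. pmf (conv_pow \<mu> i) x) sums (\<gamma> * reach x)"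
  unfolding sums_def
proof (rule increasing_limit[where K = "{}" and b = "\<lambda>x. of_bool (x = \<one>\<^bsub>B3Z\<^esub>)", OF _ _ _ _ _ _ _ x])
  show dec: "decays (\<lambda>x. \<gamma> * reach x)" using \<gamma>(1) by (intro decays_cmult reach_decays)
  show eq: "\<gamma> * reach z = of_bool (z = \<one>\<^bsub>B3Z\<^esub>) + avg (\<lambda>x. \<gamma> * reach x) z" if "z \<in> carrier B3Z" for z
    using that \<gamma>(2) reach_harmonic[of z] by (cases "z = \<one>\<^bsub>B3Z\<^esub>") (simp_all add: avg_cmult)
  show step: "(\<Sum>i<Suc n. pmf (conv_pow \<mu> i) z)
      = of_bool (z = \<one>\<^bsub>B3Z\<^esub>) + avg (\<lambda>z. \<Sum>i<n. pmf (conv_pow \<mu> i) z) z" if "z \<in> carrier B3Z" for n z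
    unfolding sum.lessThan_Suc_shift avg_sum pmf_conv_pow_Suc[OF that]
    by (simp add: indicator_def)
  show "(\<Sum>i<n. pmf (conv_pow \<mu> i) z) \<le> \<gamma> * reach z" if "z \<in> carrier B3Z" for n z
    using that
  proof (induction n arbitrary: z)
    case 0
    then show ?case using \<gamma>(1) reach_nonneg by simp
  next
    case (Suc n)
    show ?case unfolding step[OF Suc.prems] eq[OF Suc.prems]
      by (intro add_left_mono avg_mono Suc)
  qed
qed auto

lemma Green_eq: "x \<in> carrier B3Z \<Longrightarrow> Green \<mu> x = ennreal (\<gamma> * reach x)"
  unfolding Green_def by (rule suminf_ennreal_eq) (simp_all add: conv_pow_sums)

end

section \<open>Assembly of the four claims\<close>

theorem proposition5p1:
  fixes \<mu> :: "b3z pmf"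
    and r q :: "b3z \<Rightarrow> real"
    and M :: "'w measure"
    and y Y :: "nat \<Rightarrow> 'w \<Rightarrow> b3z"
  assumes supp: "set_pmf \<mu> \<subseteq> Sig"
    and gen: "(\<Union>n. set_pmf (conv_pow \<mu> n)) = carrier B3Z"
    and r_pos: "\<forall>u\<in>Sig. 0 < r u"
    and r_sum: "(\<Sum>u\<in>Sig. r u) = 1"
    and r_traffic: "traffic_equations \<mu> r"
    and walk: "random_walk \<mu> M y Y"
  defines "q \<equiv> \<lambda>u. r u / sum r (Next u)"
  shows
    "(\<forall>u\<in>Sig. qhat M Y u = q u)
     \<and> (qhat M Y \<one>\<^bsub>B3Z\<^esub> = (\<Sum>u\<in>Sig. pmf \<mu> u * q (inv\<^bsub>B3Z\<^esub> u))
        \<and> qhat M Y \<Delta> = (\<Sum>u\<in>Sig. pmf \<mu> u * q (inv\<^bsub>B3Z\<^esub> u \<otimes>\<^bsub>B3Z\<^esub> \<Delta>)))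
     \<and> (reach_prob M Y \<Delta> = qhat M Y \<Delta> / (1 - qhat M Y \<one>\<^bsub>B3Z\<^esub>)
        \<and> (\<forall>v\<in>carrier B3Z - {\<one>\<^bsub>B3Z\<^esub>, \<Delta>}.
             reach_prob M Y v = (\<Sum>us\<in>psi_inv v.
               prod_list (map q (butlast us))
               * (q (last us) + q (last us \<otimes>\<^bsub>B3Z\<^esub> \<Delta>) * reach_prob M Y \<Delta>))))
     \<and> ((\<forall>u\<in>carrier B3Z. Green \<mu> u = Green \<mu> \<one>\<^bsub>B3Z\<^esub> * ennreal (reach_prob M Y u))
        \<and> Green \<mu> \<one>\<^bsub>B3Z\<^esub> = ennreal ((1 - qhat M Y \<one>\<^bsub>B3Z\<^esub>)
             / ((1 - qhat M Y \<one>\<^bsub>B3Z\<^esub>)\<^sup>2 - (qhat M Y \<Delta>)\<^sup>2)))"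
proof -
  interpret T: traffic_solution \<mu> r
    using supp gen r_pos r_traffic by unfold_locales auto
  interpret W: walk \<mu> M y Y
    using walk by unfold_locales
  have q: "q = T.q" by (simp add: q_def T.q_def fun_eq_iff)
  \<comment> \<open>The truncated probabilities have both a probabilistic and an analytic limit. The
    identity holds on the whole group, so it gives \<open>qhat\<close> on \<open>\<Sigma>\<close> as
    well as at \<open>1\<close> and \<open>\<Delta>\<close>.\<close>
  have qhat: "qhat M Y u = T.avg T.H u" if "u \<in> carrier B3Z" for u
    using W.qhat_lim[OF that] T.avg_tendsto[OF that T.hit_coset_tendsto] by (rule LIMSEQ_unique)
  have reach: "reach_prob M Y u = T.reach u" if "u \<in> carrier B3Z" for u
    using W.reach_prob_lim[OF that] T.hit_one_tendsto[OF that] by (rule LIMSEQ_unique)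
  have q1: "qhat M Y \<one>\<^bsub>B3Z\<^esub> = T.avg T.H \<one>\<^bsub>B3Z\<^esub>" and qD: "qhat M Y \<Delta> = T.avg T.H \<Delta>"
    and rD: "reach_prob M Y \<Delta> = T.\<alpha>"
    using qhat reach by simp_all
  have G1: "Green \<mu> \<one>\<^bsub>B3Z\<^esub> = ennreal T.\<gamma>"
    by (simp add: T.Green_eq)
  show ?thesis
  proof (intro conjI ballI)
    show "qhat M Y u = q u" if "u \<in> Sig" for u
      using that by (simp add: qhat Sig_closed T.avg_H_Sig q)
    show "qhat M Y \<one>\<^bsub>B3Z\<^esub> = (\<Sum>u\<in>Sig. pmf \<mu> u * q (inv\<^bsub>B3Z\<^esub> u))"
      unfolding q1 T.avg_H_one q ..
    show "qhat M Y \<Delta> = (\<Sum>u\<in>Sig. pmf \<mu> u * q (inv\<^bsub>B3Z\<^esub> u \<otimes>\<^bsub>B3Z\<^esub> \<Delta>))"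
      unfolding qD T.avg_H_Delta q ..
    show "reach_prob M Y \<Delta> = qhat M Y \<Delta> / (1 - qhat M Y \<one>\<^bsub>B3Z\<^esub>)"
      unfolding q1 qD rD T.\<alpha>_def ..
    show "reach_prob M Y v = (\<Sum>us\<in>psi_inv v. prod_list (map q (butlast us))
        * (q (last us) + q (last us \<otimes>\<^bsub>B3Z\<^esub> \<Delta>) * reach_prob M Y \<Delta>))"
      if "v \<in> carrier B3Z - {\<one>\<^bsub>B3Z\<^esub>, \<Delta>}" for v
      using that unfolding rD q by (simp add: reach T.reach_psi_inv)
    show "Green \<mu> u = Green \<mu> \<one>\<^bsub>B3Z\<^esub> * ennreal (reach_prob M Y u)" if "u \<in> carrier B3Z" for u
      using that T.\<gamma>(1) T.reach_nonneg by (simp add: G1 T.Green_eq reach ennreal_mult')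
    show "Green \<mu> \<one>\<^bsub>B3Z\<^esub> = ennreal ((1 - qhat M Y \<one>\<^bsub>B3Z\<^esub>)
        / ((1 - qhat M Y \<one>\<^bsub>B3Z\<^esub>)\<^sup>2 - (qhat M Y \<Delta>)\<^sup>2))"
      unfolding q1 qD G1 T.\<gamma>_def ..
  qed
qed

end
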